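(* Let $A$ be a Hopf algebra with antipode $S_A$, and let $\Omega(A)=(H,\triangleleft,\triangleright,f)$ with multiplication $\cdot$ on $H$ and $\Omega'(A)=(H,\triangleleft',\triangleright',f')$ with multiplication $\cdot'$ on $H$ be two Hopf algebra extending structures of $A$ having the same underlying coalgebra $H$ and the same unit $1_H$. Then there exists a $k$-linear map $\varphi:A\ltimes' H\to A\ltimes H$ which is simultaneously a left $A$-module map, a right $H$-comodule map and a Hopf algebra map if and only if $\triangleleft'=\triangleleft$ and there exists a coalgebra lazy $1$-cocycle $u\in H^1_{l,c}(H,A)$ such that for all $h,g\in H$, $c\in A$: (i) $h\triangleright' c=u(h_{(1)})\,(h_{(2)}\triangleright c_{(1)})\,S_A\bigl(u(h_{(3)}\triangleleft c_{(2)})\bigr)$; (ii) $f'(h,g)=u(h_{(1)})\,\bigl(h_{(2)}\triangleright u(g_{(1)})\bigr)\,f\bigl(h_{(3)}\triangleleft u(g_{(2)}),\,g_{(3)}\bigr)\,S_A\bigl(u(h_{(4)}\cdot' g_{(4)})\bigr)$; (iii) $h\cdot' g=\bigl(h\triangleleft u(g_{(1)})\bigr)\cdot g_{(2)}$. In this case $\varphi(a\ltimes' h)=a\,u(h_{(1)})\ltimes h_{(2)}$ and $\varphi$ is an isomorphism.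
   Context: $k$ is a field; Sweedler notation. An extending datum of a bialgebra $A$ is a system $(H,\triangleleft,\triangleright,f)$ where $H$ is a coalgebra $(\Delta_H,\varepsilon_H)$ with a unital, not necessarily associative multiplication $\cdot$ and unit $1_H$ with $\Delta_H(1_H)=1_H\otimes 1_H$, and $\triangleleft:H\otimes A\to H$, $\triangleright:H\otimes A\to A$, $f:H\otimes H\to A$ are coalgebra maps satisfying $h\triangleright 1_A=\varepsilon_H(h)1_A$, $1_H\triangleright a=a$, $1_H\triangleleft a=\varepsilon_A(a)1_H$, $h\triangleleft 1_A=h$, $f(h,1_H)=f(1_H,h)=\varepsilon_H(h)1_A$. The unified product $A\ltimes H$ is $A\otimes H$ (elements written $a\ltimes h$) with multiplication $(a\ltimes h)\bullet(c\ltimes g)=a(h_{(1)}\triangleright c_{(1)})f(h_{(2)}\triangleleft c_{(2)},g_{(1)})\ltimes(h_{(3)}\triangleleft c_{(3)})\cdot g_{(2)}$, unit $1_A\ltimes 1_H$ and tensor product coalgebra structure; the datum is a Hopf algebra extending structure if $A\ltimes H$ is then a Hopf algebra. $A\ltimes' H$ is built in the same way from $\Omega'(A)$ and $\cdot'$. Each unified product is a left $A$-module via $b\cdot(a\ltimes h)=ba\ltimes h$ and a right $H$-comodule via $a\ltimes h\mapsto a\ltimes h_{(1)}\otimes h_{(2)}$. A coalgebra lazy $1$-cocycle is a coalgebra map $u:H\to A$ with $u(1_H)=1_A$ and $h_{(1)}\otimes u(h_{(2)})=h_{(2)}\otimes u(h_{(1)})$ for all $h\in H$; $H^1_{l,c}(H,A)$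 is the set of these. *)

theory Defs
  imports Complex_Main "HOL-Library.Multiset"
begin

text \<open>A k-vector space is a type 'v of class ab_group_add with a scalar multiplication
  sc :: 'k => 'v => 'v satisfying the vector space axioms (library predicate vector_space).
  An element of a tensor product V1 (x) ... (x) Vn is represented by a finite formal sum of
  pure tensors, i.e. a multiset of tuples. Two representatives denote the same tensor iff
  every n-linear form V1 x ... x Vn -> k takes the same value on them (linear forms on a
  tensor product correspond to multilinear forms, and linear forms separate points).
  A comultiplication is a map returning a representative of Delta(x); Sweedler sums
  x_(1) ... x_(n) applied to a multilinear expression are evaluated on representatives
  (the result is independent of the representative since the expression is multilinear).\<close>

record ('k, 'v) kstr =
  sc  :: "'k \<Rightarrow> 'v \<Rightarrow> 'v"
  mul :: "'v \<Rightarrow> 'v \<Rightarrow> 'v"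
  one :: "'v"
  cm  :: "'v \<Rightarrow> ('v \<times> 'v) multiset"  \<comment> \<open>comultiplication (representative of Delta x)\<close>
  cu  :: "'v \<Rightarrow> 'k"

definition bilin where
  "bilin s1 s2 s3 B \<longleftrightarrow> (\<forall>x. Vector_Spaces.linear s2 s3 (B x)) \<and> (\<forall>y. Vector_Spaces.linear s1 s3 (\<lambda>x. B x y))"

definition trilin where
  "trilin s1 s2 s3 s4 T \<longleftrightarrow> (\<forall>x y. Vector_Spaces.linear s3 s4 (T x y))
     \<and> (\<forall>x z. Vector_Spaces.linear s2 s4 (\<lambda>y. T x y z)) \<and> (\<forall>y z. Vector_Spaces.linear s1 s4 (\<lambda>x. T x y z))"

definition quadlin where
  "quadlin s1 s2 s3 s4 s5 Q \<longleftrightarrow> (\<forall>x y z. Vector_Spaces.linear s4 s5 (Q x y z))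
     \<and> (\<forall>x y w. Vector_Spaces.linear s3 s5 (\<lambda>z. Q x y z w))
     \<and> (\<forall>x z w. Vector_Spaces.linear s2 s5 (\<lambda>y. Q x y z w))
     \<and> (\<forall>y z w. Vector_Spaces.linear s1 s5 (\<lambda>x. Q x y z w))"

definition ev2 :: "('x \<Rightarrow> 'y \<Rightarrow> 'c::comm_monoid_add) \<Rightarrow> ('x \<times> 'y) multiset \<Rightarrow> 'c" where
  "ev2 B M = sum_mset (image_mset (\<lambda>(x, y). B x y) M)"

definition ev3 :: "('x \<Rightarrow> 'y \<Rightarrow> 'z \<Rightarrow> 'c::comm_monoid_add) \<Rightarrow> ('x \<times> 'y \<times> 'z) multiset \<Rightarrow> 'c" where
  "ev3 T M = sum_mset (image_mset (\<lambda>(x, y, z). T x y z) M)"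

definition ev4 :: "('x \<Rightarrow> 'y \<Rightarrow> 'z \<Rightarrow> 'w \<Rightarrow> 'c::comm_monoid_add) \<Rightarrow> ('x \<times> 'y \<times> 'z \<times> 'w) multiset \<Rightarrow> 'c" where
  "ev4 Q M = sum_mset (image_mset (\<lambda>(x, y, z, w). Q x y z w) M)"

definition teq2 :: "('k::field \<Rightarrow> 'x::ab_group_add \<Rightarrow> 'x) \<Rightarrow> ('k \<Rightarrow> 'y::ab_group_add \<Rightarrow> 'y)
    \<Rightarrow> ('x \<times> 'y) multiset \<Rightarrow> ('x \<times> 'y) multiset \<Rightarrow> bool" where
  "teq2 s1 s2 M N \<longleftrightarrow> (\<forall>\<beta>. bilin s1 s2 ((*) :: 'k \<Rightarrow> 'k \<Rightarrow> 'k) \<beta> \<longrightarrow> ev2 \<beta> M = ev2 \<beta> N)"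

definition teq3 :: "('k::field \<Rightarrow> 'x::ab_group_add \<Rightarrow> 'x) \<Rightarrow> ('k \<Rightarrow> 'y::ab_group_add \<Rightarrow> 'y)
    \<Rightarrow> ('k \<Rightarrow> 'z::ab_group_add \<Rightarrow> 'z) \<Rightarrow> ('x \<times> 'y \<times> 'z) multiset \<Rightarrow> ('x \<times> 'y \<times> 'z) multiset \<Rightarrow> bool" where
  "teq3 s1 s2 s3 M N \<longleftrightarrow> (\<forall>\<tau>. trilin s1 s2 s3 ((*) :: 'k \<Rightarrow> 'k \<Rightarrow> 'k) \<tau> \<longrightarrow> ev3 \<tau> M = ev3 \<tau> N)"

definition teq4 :: "('k::field \<Rightarrow> 'x::ab_group_add \<Rightarrow> 'x) \<Rightarrow> ('k \<Rightarrow> 'y::ab_group_add \<Rightarrow> 'y)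
    \<Rightarrow> ('k \<Rightarrow> 'z::ab_group_add \<Rightarrow> 'z) \<Rightarrow> ('k \<Rightarrow> 'w::ab_group_add \<Rightarrow> 'w)
    \<Rightarrow> ('x \<times> 'y \<times> 'z \<times> 'w) multiset \<Rightarrow> ('x \<times> 'y \<times> 'z \<times> 'w) multiset \<Rightarrow> bool" where
  "teq4 s1 s2 s3 s4 M N \<longleftrightarrow> (\<forall>\<chi>. quadlin s1 s2 s3 s4 ((*) :: 'k \<Rightarrow> 'k \<Rightarrow> 'k) \<chi> \<longrightarrow> ev4 \<chi> M = ev4 \<chi> N)"

definition sw2 :: "('x \<Rightarrow> ('x \<times> 'x) multiset) \<Rightarrow> 'x \<Rightarrow> ('x \<Rightarrow> 'x \<Rightarrow> 'c::comm_monoid_add) \<Rightarrow> 'c" where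
  "sw2 D x B = ev2 B (D x)"

definition sw3 :: "('x \<Rightarrow> ('x \<times> 'x) multiset) \<Rightarrow> 'x \<Rightarrow> ('x \<Rightarrow> 'x \<Rightarrow> 'x \<Rightarrow> 'c::comm_monoid_add) \<Rightarrow> 'c" where
  "sw3 D x T = sw2 D x (\<lambda>x1 y. sw2 D y (T x1))"

definition sw4 :: "('x \<Rightarrow> ('x \<times> 'x) multiset) \<Rightarrow> 'x \<Rightarrow> ('x \<Rightarrow> 'x \<Rightarrow> 'x \<Rightarrow> 'x \<Rightarrow> 'c::comm_monoid_add) \<Rightarrow> 'c" where
  "sw4 D x Q = sw2 D x (\<lambda>x1 y. sw3 D y (Q x1))"

definition coalg :: "('k::field, 'v::ab_group_add) kstr \<Rightarrow> bool" where
  "coalg V \<longleftrightarrow> vector_space (sc V)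
     \<and> Vector_Spaces.linear (sc V) ((*) :: 'k \<Rightarrow> 'k \<Rightarrow> 'k) (cu V)
     \<and> (\<forall>\<beta>. bilin (sc V) (sc V) ((*) :: 'k \<Rightarrow> 'k \<Rightarrow> 'k) \<beta>
            \<longrightarrow> Vector_Spaces.linear (sc V) ((*) :: 'k \<Rightarrow> 'k \<Rightarrow> 'k) (\<lambda>x. ev2 \<beta> (cm V x)))
     \<and> (\<forall>x \<tau>. trilin (sc V) (sc V) (sc V) ((*) :: 'k \<Rightarrow> 'k \<Rightarrow> 'k) \<tau>
            \<longrightarrow> sw2 (cm V) x (\<lambda>y z. sw2 (cm V) z (\<tau> y)) = sw2 (cm V) x (\<lambda>y z. sw2 (cm V) y (\<lambda>p q. \<tau> p q z)))
     \<and> (\<forall>x. sw2 (cm V) x (\<lambda>y z. sc V (cu V y) z) = x)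
     \<and> (\<forall>x. sw2 (cm V) x (\<lambda>y z. sc V (cu V z) y) = x)"

definition kalgebra :: "('k::field, 'v::ab_group_add) kstr \<Rightarrow> bool" where
  "kalgebra V \<longleftrightarrow> vector_space (sc V) \<and> bilin (sc V) (sc V) (sc V) (mul V)
     \<and> (\<forall>a b c. mul V (mul V a b) c = mul V a (mul V b c))
     \<and> (\<forall>a. mul V (one V) a = a \<and> mul V a (one V) = a)"

definition bialg :: "('k::field, 'v::ab_group_add) kstr \<Rightarrow> bool" where
  "bialg V \<longleftrightarrow> kalgebra V \<and> coalg V
     \<and> (\<forall>a b. teq2 (sc V) (sc V) (cm V (mul V a b))
              (sw2 (cm V) a (\<lambda>a1 a2. sw2 (cm V) b (\<lambda>b1 b2. {#(mul V a1 b1, mul V a2 b2)#}))))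
     \<and> teq2 (sc V) (sc V) (cm V (one V)) {#(one V, one V)#}
     \<and> (\<forall>a b. cu V (mul V a b) = cu V a * cu V b) \<and> cu V (one V) = 1"

definition hopf_alg :: "('k::field, 'v::ab_group_add) kstr \<Rightarrow> ('v \<Rightarrow> 'v) \<Rightarrow> bool" where
  "hopf_alg V S \<longleftrightarrow> bialg V \<and> Vector_Spaces.linear (sc V) (sc V) S
     \<and> (\<forall>a. sw2 (cm V) a (\<lambda>x y. mul V (S x) y) = sc V (cu V a) (one V)
          \<and> sw2 (cm V) a (\<lambda>x y. mul V x (S y)) = sc V (cu V a) (one V))"

text \<open>B : V (x) W -> U (given as a bilinear map) is a coalgebra map, V (x) W carrying the
  tensor product coalgebra structure.\<close>
definition cmap2 :: "('k::field, 'v::ab_group_add) kstr \<Rightarrow> ('k, 'w::ab_group_add) kstr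
    \<Rightarrow> ('k, 'u::ab_group_add) kstr \<Rightarrow> ('v \<Rightarrow> 'w \<Rightarrow> 'u) \<Rightarrow> bool" where
  "cmap2 V W U B \<longleftrightarrow> bilin (sc V) (sc W) (sc U) B
     \<and> (\<forall>x y. teq2 (sc U) (sc U) (cm U (B x y))
                (sw2 (cm V) x (\<lambda>x1 x2. sw2 (cm W) y (\<lambda>y1 y2. {#(B x1 y1, B x2 y2)#})))
            \<and> cu U (B x y) = cu V x * cu W y)"

text \<open>Extending datum (H, lt, rt, f) of A: H is a coalgebra (sc H, cm H, cu H) with a unital
  (not necessarily associative) bilinear multiplication mul H and unit one H;
  lt = triangleleft, rt = triangleright.\<close>
definition ext_datum :: "('k::field, 'a::ab_group_add) kstr \<Rightarrow> ('k, 'h::ab_group_add) kstr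
    \<Rightarrow> ('h \<Rightarrow> 'a \<Rightarrow> 'h) \<Rightarrow> ('h \<Rightarrow> 'a \<Rightarrow> 'a) \<Rightarrow> ('h \<Rightarrow> 'h \<Rightarrow> 'a) \<Rightarrow> bool" where
  "ext_datum A H lt rt f \<longleftrightarrow> coalg H \<and> bilin (sc H) (sc H) (sc H) (mul H)
     \<and> (\<forall>h. mul H (one H) h = h \<and> mul H h (one H) = h)
     \<and> teq2 (sc H) (sc H) (cm H (one H)) {#(one H, one H)#}
     \<and> cmap2 H A H lt \<and> cmap2 H A A rt \<and> cmap2 H H A f
     \<and> (\<forall>h. rt h (one A) = sc A (cu H h) (one A))
     \<and> (\<forall>a. rt (one H) a = a)
     \<and> (\<forall>a. lt (one H) a = sc H (cu A a) (one H))
     \<and> (\<forall>h. lt h (one A) = h)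
     \<and> (\<forall>h. f h (one H) = sc A (cu H h) (one A) \<and> f (one H) h = sc A (cu H h) (one A))"

text \<open>Product of pure tensors (a |x h) . (c |x g) in the unified product A |x H.\<close>
definition upp :: "('k::field, 'a::ab_group_add) kstr \<Rightarrow> ('k, 'h::ab_group_add) kstr
    \<Rightarrow> ('h \<Rightarrow> 'a \<Rightarrow> 'h) \<Rightarrow> ('h \<Rightarrow> 'a \<Rightarrow> 'a) \<Rightarrow> ('h \<Rightarrow> 'h \<Rightarrow> 'a)
    \<Rightarrow> 'a \<Rightarrow> 'h \<Rightarrow> 'a \<Rightarrow> 'h \<Rightarrow> ('a \<times> 'h) multiset" where
  "upp A H lt rt f a h c g =
     sw3 (cm H) h (\<lambda>h1 h2 h3. sw3 (cm A) c (\<lambda>c1 c2 c3. sw2 (cm H) g (\<lambda>g1 g2.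
        {#(mul A (mul A a (rt h1 c1)) (f (lt h2 c2) g1), mul H (lt h3 c3) g2)#})))"

definition upm where
  "upm A H lt rt f M N =
     sum_mset (image_mset (\<lambda>(a, h). sum_mset (image_mset (\<lambda>(c, g). upp A H lt rt f a h c g) N)) M)"

text \<open>Tensor product coalgebra structure on A (x) H; Delta lands in (A (x) H) (x) (A (x) H),
  represented by 4-tuples.\<close>
definition cmT :: "('k, 'a) kstr \<Rightarrow> ('k, 'h) kstr \<Rightarrow> 'a \<Rightarrow> 'h \<Rightarrow> ('a \<times> 'h \<times> 'a \<times> 'h) multiset" where
  "cmT A H a h = sw2 (cm A) a (\<lambda>a1 a2. sw2 (cm H) h (\<lambda>h1 h2. {#(a1, h1, a2, h2)#}))"

definition cmR where
  "cmR A H M = sum_mset (image_mset (\<lambda>(a, h). cmT A H a h) M)"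

definition cuR :: "('k::comm_ring_1, 'a) kstr \<Rightarrow> ('k, 'h) kstr \<Rightarrow> ('a \<times> 'h) multiset \<Rightarrow> 'k" where
  "cuR A H M = sum_mset (image_mset (\<lambda>(a, h). cu A a * cu H h) M)"

definition pair4 :: "('a \<times> 'h) multiset \<Rightarrow> ('a \<times> 'h) multiset \<Rightarrow> ('a \<times> 'h \<times> 'a \<times> 'h) multiset" where
  "pair4 M N = sum_mset (image_mset (\<lambda>(a, h). sum_mset (image_mset (\<lambda>(c, g). {#(a, h, c, g)#}) N)) M)"

definition up4 where
  "up4 A H lt rt f P Q =
     sum_mset (image_mset (\<lambda>(a, h, a', h'). sum_mset (image_mset (\<lambda>(c, g, c', g').
        pair4 (upp A H lt rt f a h c g) (upp A H lt rt f a' h' c' g')) Q)) P)"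

text \<open>Linear maps A (x) H -> A (x) H, given by their (bilinear) values on pure tensors, and
  their extension to representatives.\<close>
definition tlin :: "('k::field, 'a::ab_group_add) kstr \<Rightarrow> ('k, 'h::ab_group_add) kstr
    \<Rightarrow> ('a \<Rightarrow> 'h \<Rightarrow> ('a \<times> 'h) multiset) \<Rightarrow> bool" where
  "tlin A H \<Phi> \<longleftrightarrow> (\<forall>\<beta>. bilin (sc A) (sc H) ((*) :: 'k \<Rightarrow> 'k \<Rightarrow> 'k) \<beta>
       \<longrightarrow> bilin (sc A) (sc H) ((*) :: 'k \<Rightarrow> 'k \<Rightarrow> 'k) (\<lambda>a h. ev2 \<beta> (\<Phi> a h)))"

definition extR :: "('a \<Rightarrow> 'h \<Rightarrow> ('a \<times> 'h) multiset) \<Rightarrow> ('a \<times> 'h) multiset \<Rightarrow> ('a \<times> 'h) multiset" where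
  "extR \<Phi> M = sum_mset (image_mset (\<lambda>(a, h). \<Phi> a h) M)"

definition unified_hopf :: "('k::field, 'a::ab_group_add) kstr \<Rightarrow> ('k, 'h::ab_group_add) kstr
    \<Rightarrow> ('h \<Rightarrow> 'a \<Rightarrow> 'h) \<Rightarrow> ('h \<Rightarrow> 'a \<Rightarrow> 'a) \<Rightarrow> ('h \<Rightarrow> 'h \<Rightarrow> 'a) \<Rightarrow> bool" where
  "unified_hopf A H lt rt f \<longleftrightarrow>
     (\<forall>x y z. teq2 (sc A) (sc H) (upm A H lt rt f (upm A H lt rt f x y) z) (upm A H lt rt f x (upm A H lt rt f y z)))
   \<and> (\<forall>x. teq2 (sc A) (sc H) (upm A H lt rt f {#(one A, one H)#} x) x
         \<and> teq2 (sc A) (sc H) (upm A H lt rt f x {#(one A, one H)#}) x)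
   \<and> (\<forall>x y. teq4 (sc A) (sc H) (sc A) (sc H) (cmR A H (upm A H lt rt f x y)) (up4 A H lt rt f (cmR A H x) (cmR A H y)))
   \<and> teq4 (sc A) (sc H) (sc A) (sc H) (cmT A H (one A) (one H)) {#(one A, one H, one A, one H)#}
   \<and> (\<forall>x y. cuR A H (upm A H lt rt f x y) = cuR A H x * cuR A H y)
   \<and> cuR A H {#(one A, one H)#} = 1
   \<and> (\<exists>S. tlin A H S \<and> (\<forall>a h.
        teq2 (sc A) (sc H) (sum_mset (image_mset (\<lambda>(a1, h1, a2, h2). upm A H lt rt f (S a1 h1) {#(a2, h2)#}) (cmT A H a h)))
             {#(sc A (cu A a * cu H h) (one A), one H)#}
      \<and> teq2 (sc A) (sc H) (sum_mset (image_mset (\<lambda>(a1, h1, a2, h2). upm A H lt rt f {#(a1, h1)#} (S a2 h2)) (cmT A H a h)))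
             {#(sc A (cu A a * cu H h) (one A), one H)#}))"

definition hopf_ext where
  "hopf_ext A H lt rt f \<longleftrightarrow> ext_datum A H lt rt f \<and> unified_hopf A H lt rt f"

text \<open>Phi : A |x' H -> A |x H (source built from H' = H with multiplication mul H' and
  lt', rt', f'; target from H, lt, rt, f) is a k-linear map which is a left A-module map,
  a right H-comodule map and a Hopf algebra (= bialgebra) map.\<close>
definition good_morph :: "('k::field, 'a::ab_group_add) kstr \<Rightarrow> ('k, 'h::ab_group_add) kstr
    \<Rightarrow> ('h \<Rightarrow> 'a \<Rightarrow> 'h) \<Rightarrow> ('h \<Rightarrow> 'a \<Rightarrow> 'a) \<Rightarrow> ('h \<Rightarrow> 'h \<Rightarrow> 'a)
    \<Rightarrow> ('k, 'h) kstr \<Rightarrow> ('h \<Rightarrow> 'a \<Rightarrow> 'h) \<Rightarrow> ('h \<Rightarrow> 'a \<Rightarrow> 'a) \<Rightarrow> ('h \<Rightarrow> 'h \<Rightarrow> 'a)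
    \<Rightarrow> ('a \<Rightarrow> 'h \<Rightarrow> ('a \<times> 'h) multiset) \<Rightarrow> bool" where
  "good_morph A H lt rt f H' lt' rt' f' \<Phi> \<longleftrightarrow> tlin A H \<Phi>
   \<comment> \<open>left A-module map\<close>
   \<and> (\<forall>b a h. teq2 (sc A) (sc H) (\<Phi> (mul A b a) h) (image_mset (\<lambda>(p, q). (mul A b p, q)) (\<Phi> a h)))
   \<comment> \<open>right H-comodule map\<close>
   \<and> (\<forall>a h. teq3 (sc A) (sc H) (sc H)
        (sw2 (cm H) h (\<lambda>h1 h2. image_mset (\<lambda>(p, q). (p, q, h2)) (\<Phi> a h1)))
        (sum_mset (image_mset (\<lambda>(p, q). sw2 (cm H) q (\<lambda>q1 q2. {#(p, q1, q2)#})) (\<Phi> a h))))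
   \<comment> \<open>algebra map\<close>
   \<and> (\<forall>a h c g. teq2 (sc A) (sc H) (extR \<Phi> (upp A H' lt' rt' f' a h c g)) (upm A H lt rt f (\<Phi> a h) (\<Phi> c g)))
   \<and> teq2 (sc A) (sc H) (\<Phi> (one A) (one H)) {#(one A, one H)#}
   \<comment> \<open>coalgebra map\<close>
   \<and> (\<forall>a h. teq4 (sc A) (sc H) (sc A) (sc H) (cmR A H (\<Phi> a h))
        (sum_mset (image_mset (\<lambda>(a1, h1, a2, h2). pair4 (\<Phi> a1 h1) (\<Phi> a2 h2)) (cmT A H a h))))
   \<and> (\<forall>a h. cuR A H (\<Phi> a h) = cu A a * cu H h)"

definition tiso :: "('k::field, 'a::ab_group_add) kstr \<Rightarrow> ('k, 'h::ab_group_add) kstr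
    \<Rightarrow> ('a \<Rightarrow> 'h \<Rightarrow> ('a \<times> 'h) multiset) \<Rightarrow> bool" where
  "tiso A H \<Phi> \<longleftrightarrow> (\<exists>\<Psi>. tlin A H \<Psi> \<and> (\<forall>a h. teq2 (sc A) (sc H) (extR \<Psi> (\<Phi> a h)) {#(a, h)#}
                                         \<and> teq2 (sc A) (sc H) (extR \<Phi> (\<Psi> a h)) {#(a, h)#}))"

definition lazy_cocycle :: "('k::field, 'a::ab_group_add) kstr \<Rightarrow> ('k, 'h::ab_group_add) kstr
    \<Rightarrow> ('h \<Rightarrow> 'a) \<Rightarrow> bool" where
  "lazy_cocycle A H u \<longleftrightarrow> Vector_Spaces.linear (sc H) (sc A) u
     \<and> (\<forall>h. teq2 (sc A) (sc A) (cm A (u h)) (sw2 (cm H) h (\<lambda>x y. {#(u x, u y)#})) \<and> cu A (u h) = cu H h)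
     \<and> u (one H) = one A
     \<and> (\<forall>h. teq2 (sc H) (sc A) (sw2 (cm H) h (\<lambda>x y. {#(x, u y)#})) (sw2 (cm H) h (\<lambda>x y. {#(y, u x)#})))"

definition conds :: "('k::field, 'a::ab_group_add) kstr \<Rightarrow> ('a \<Rightarrow> 'a) \<Rightarrow> ('k, 'h::ab_group_add) kstr
    \<Rightarrow> ('h \<Rightarrow> 'a \<Rightarrow> 'h) \<Rightarrow> ('h \<Rightarrow> 'a \<Rightarrow> 'a) \<Rightarrow> ('h \<Rightarrow> 'h \<Rightarrow> 'a)
    \<Rightarrow> ('h \<Rightarrow> 'h \<Rightarrow> 'h) \<Rightarrow> ('h \<Rightarrow> 'a \<Rightarrow> 'a) \<Rightarrow> ('h \<Rightarrow> 'h \<Rightarrow> 'a) \<Rightarrow> ('h \<Rightarrow> 'a) \<Rightarrow> bool" where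
  "conds A SA H lt rt f mH' rt' f' u \<longleftrightarrow>
     (\<forall>h c. rt' h c = sw3 (cm H) h (\<lambda>h1 h2 h3. sw2 (cm A) c (\<lambda>c1 c2.
                 mul A (mul A (u h1) (rt h2 c1)) (SA (u (lt h3 c2))))))
   \<and> (\<forall>h g. f' h g = sw4 (cm H) h (\<lambda>h1 h2 h3 h4. sw4 (cm H) g (\<lambda>g1 g2 g3 g4.
                 mul A (mul A (mul A (u h1) (rt h2 (u g1))) (f (lt h3 (u g2)) g3)) (SA (u (mH' h4 g4))))))
   \<and> (\<forall>h g. mH' h g = sw2 (cm H) g (\<lambda>g1 g2. mul H (lt h (u g1)) g2))"

definition phi_of :: "('k, 'a) kstr \<Rightarrow> ('k, 'h) kstr \<Rightarrow> ('h \<Rightarrow> 'a) \<Rightarrow> 'a \<Rightarrow> 'h \<Rightarrow> ('a \<times> 'h) multiset" where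
  "phi_of A H u a h = sw2 (cm H) h (\<lambda>h1 h2. {#(mul A a (u h1), h2)#})"

end

theory Submission
  imports Defs
begin

text \<open>A left \<open>A\<close>-linear, right \<open>H\<close>-colinear \<open>\<Phi>\<close> is determined by \<open>u = (id \<otimes> \<epsilon>) \<circ> \<Phi> (1 \<otimes> -)\<close>, namely
  \<open>\<Phi> (a \<otimes> h) = a u(h\<^sub>1) \<otimes> h\<^sub>2\<close>, and compatibility with the coalgebra structures says that \<open>u\<close> is a lazy
  cocycle. By associativity of \<open>A \<ltimes> H\<close>, \<open>\<Phi>\<close> is multiplicative as soon as it is so on the products
  \<open>(1 \<ltimes> h) \<bullet>' (c \<ltimes> 1)\<close> and \<open>(1 \<ltimes> h) \<bullet>' (1 \<ltimes> g)\<close>. On these both sides have the form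
  \<open>P(x\<^sub>1) \<otimes> Q(x\<^sub>2)\<close> with \<open>x\<close> in the coalgebra \<open>H \<otimes> A\<close> or \<open>H \<otimes> H\<close> and \<open>P\<close>, \<open>Q\<close> compatible with counits, so
  they agree iff the factors do. The equations for \<open>Q\<close> are \<open>\<triangleleft>' = \<triangleleft>\<close> and (iii); those for \<open>P\<close> become (i)
  and (ii) after convolution with the inverse \<open>S\<^sub>A \<circ> u \<circ> Q\<close> of \<open>u \<circ> Q\<close>.\<close>

abbreviation lin :: "('k::field \<Rightarrow> 'x::ab_group_add \<Rightarrow> 'x) \<Rightarrow> ('k \<Rightarrow> 'y::ab_group_add \<Rightarrow> 'y) \<Rightarrow> ('x \<Rightarrow> 'y) \<Rightarrow> bool"
  where "lin \<equiv> Vector_Spaces.linear"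

section \<open>Linear maps and linear forms\<close>

text \<open>Closure rules for linearity of composite expressions. The multilinearity side conditions
  of the Sweedler identities are discharged by introduction with these rules.\<close>

named_theorems lins

lemma vector_space_mult: "vector_space ((*) :: 'k::field \<Rightarrow> 'k \<Rightarrow> 'k)"
  by unfold_locales (auto simp: algebra_simps)

lemma linI:
  assumes "vector_space s" "vector_space t"
    and "\<And>x y. F (x + y) = F x + F y" "\<And>r x. F (s r x) = t r (F x)"
  shows "lin s t F"
  using assms by (simp add: Vector_Spaces.linear_def module_hom_def module_hom_axioms_def
      module_iff_vector_space)

lemma linD:
  assumes "lin s t F"
  shows "vector_space s" "vector_space t" "F (x + y) = F x + F y" "F (s r x) = t r (F x)" "F 0 = 0"
proof -
  interpret Vector_Spaces.linear s t F by fact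
  show "vector_space s" "vector_space t" "F (x + y) = F x + F y" "F (s r x) = t r (F x)" "F 0 = 0"
    by (simp_all add: add scale vs1.vector_space_axioms vs2.vector_space_axioms)
qed

lemma lin_ident: "vector_space s \<Longrightarrow> lin s s (\<lambda>x. x)"
  by (intro linI) auto

lemma lin_comp: "lin s2 s3 G \<Longrightarrow> lin s1 s2 F \<Longrightarrow> lin s1 s3 (\<lambda>x. G (F x))"
  by (intro linI) (auto simp: linD)

lemma lin_mult_left [lins]: "lin s (*) F \<Longrightarrow> lin s (*) (\<lambda>x. c * F x)"
  by (intro linI) (auto simp: linD algebra_simps vector_space_mult)

lemma lin_mult_right [lins]: "lin s (*) F \<Longrightarrow> lin s (*) (\<lambda>x. F x * c)"
  by (intro linI) (auto simp: linD algebra_simps vector_space_mult)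

lemma lin_scale: "vector_space t \<Longrightarrow> lin s (*) F \<Longrightarrow> lin s t (\<lambda>x. t (F x) c)"
  by (intro linI) (auto simp: linD vector_space.vector_space_assms)

lemma lin_scale_right:
  assumes "lin s t F"
  shows "lin s t (\<lambda>x. t c (F x))"
proof -
  interpret Vector_Spaces.linear s t F by fact
  show ?thesis
    by (intro linI)
      (auto simp: add scale vs1.vector_space_axioms vs2.vector_space_axioms vs2.scale_right_distrib mult.commute)
qed

lemma lin_add: "lin s t F \<Longrightarrow> lin s t G \<Longrightarrow> lin s t (\<lambda>x. F x + G x)"
  by (intro linI) (auto simp: linD algebra_simps vector_space.vector_space_assms)

text \<open>A nonzero vector \<open>x - y\<close> is independent by itself, so some linear form
  takes the value \<open>1\<close> on it. This lifts identities known for scalar-valued forms to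
  identities with values in any vector space.\<close>

lemma lin_separates:
  fixes s :: "'k::field \<Rightarrow> 'x::ab_group_add \<Rightarrow> 'x"
  assumes "vector_space s" and eq: "\<And>\<phi>. lin s ((*) :: 'k \<Rightarrow> 'k \<Rightarrow> 'k) \<phi> \<Longrightarrow> \<phi> x = \<phi> y"
  shows "x = y"
proof (rule ccontr)
  assume "x \<noteq> y"
  interpret vector_space_pair s "(*) :: 'k \<Rightarrow> 'k \<Rightarrow> 'k"
    using assms(1) vector_space_mult by (rule vector_space_pair.intro)
  have "vs1.independent {x - y}"
    using \<open>x \<noteq> y\<close> by simp
  from linear_independent_extend[OF this, of "\<lambda>_. 1"]
  obtain \<phi> where \<phi>: "lin s ((*) :: 'k \<Rightarrow> 'k \<Rightarrow> 'k) \<phi>" "\<phi> (x - y) = 1" by auto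
  have "\<phi> x = \<phi> ((x - y) + y)" by simp
  also have "\<dots> = 1 + \<phi> y" using \<phi> by (simp only: linD(3))
  finally show False using eq[OF \<phi>(1)] by simp
qed

text \<open>Since linear forms separate points, additivity and homogeneity may be tested after
  composition with every form on the target.\<close>

lemma lin_by_forms:
  fixes s :: "'k::field \<Rightarrow> 'x::ab_group_add \<Rightarrow> 'x" and t :: "'k \<Rightarrow> 'y::ab_group_add \<Rightarrow> 'y"
  assumes "vector_space s" "vector_space t"
    and F: "\<And>\<phi>. lin t ((*) :: 'k \<Rightarrow> 'k \<Rightarrow> 'k) \<phi> \<Longrightarrow> lin s (*) (\<lambda>x. \<phi> (F x))"
  shows "lin s t F"
proof (rule linI[OF assms(1,2)])
  show "F (x + y) = F x + F y" for x y
  proof (rule lin_separates[OF assms(2)])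
    fix \<phi> :: "'y \<Rightarrow> 'k" assume \<phi>: "lin t (*) \<phi>"
    show "\<phi> (F (x + y)) = \<phi> (F x + F y)" by (simp only: linD(3)[OF F[OF \<phi>]] linD(3)[OF \<phi>])
  qed
  show "F (s r x) = t r (F x)" for r x
  proof (rule lin_separates[OF assms(2)])
    fix \<phi> :: "'y \<Rightarrow> 'k" assume \<phi>: "lin t (*) \<phi>"
    show "\<phi> (F (s r x)) = \<phi> (t r (F x))" by (simp only: linD(4)[OF F[OF \<phi>]] linD(4)[OF \<phi>])
  qed
qed

lemma bilinI:
  "(\<And>x. lin s2 s3 (\<lambda>y. B x y)) \<Longrightarrow> (\<And>y. lin s1 s3 (\<lambda>x. B x y)) \<Longrightarrow> bilin s1 s2 s3 B"
  by (simp add: bilin_def)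

lemma trilinI:
  "(\<And>x y. lin s3 s4 (\<lambda>z. T x y z)) \<Longrightarrow> (\<And>x z. lin s2 s4 (\<lambda>y. T x y z)) \<Longrightarrow>
    (\<And>y z. lin s1 s4 (\<lambda>x. T x y z)) \<Longrightarrow> trilin s1 s2 s3 s4 T"
  by (simp add: trilin_def)

lemma quadlinI:
  "(\<And>x y z. lin s4 s5 (\<lambda>w. Q x y z w)) \<Longrightarrow> (\<And>x y w. lin s3 s5 (\<lambda>z. Q x y z w)) \<Longrightarrow>
    (\<And>x z w. lin s2 s5 (\<lambda>y. Q x y z w)) \<Longrightarrow> (\<And>y z w. lin s1 s5 (\<lambda>x. Q x y z w)) \<Longrightarrow>
    quadlin s1 s2 s3 s4 s5 Q"
  by (simp add: quadlin_def)

text \<open>The argument is a linear expression \<open>F x\<close> instead of a variable, so that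
  the rule can be applied backwards through nested expressions.\<close>

lemma lin_bilin1: "bilin s1 s2 s3 B \<Longrightarrow> lin s s1 F \<Longrightarrow> lin s s3 (\<lambda>x. B (F x) c)"
  unfolding bilin_def by (rule lin_comp) auto

lemma lin_bilin2: "bilin s1 s2 s3 B \<Longrightarrow> lin s s2 F \<Longrightarrow> lin s s3 (\<lambda>x. B c (F x))"
  unfolding bilin_def by (rule lin_comp) auto

lemma bilinD:
  assumes "bilin s1 s2 s3 B"
  shows "vector_space s1" "vector_space s2" "vector_space s3"
    "B (s1 r x) y = s3 r (B x y)" "B x (s2 r y) = s3 r (B x y)"
  using assms linD[of s2 s3 "B x"] linD[of s1 s3 "\<lambda>x. B x y"] by (auto simp: bilin_def)

lemmas lin_bilin = lin_bilin1 lin_bilin2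

lemma lin_trilin:
  assumes "trilin s1 s2 s3 s4 T"
  shows "lin s s1 F \<Longrightarrow> lin s s4 (\<lambda>x. T (F x) q r)" "lin s s2 G \<Longrightarrow> lin s s4 (\<lambda>x. T p (G x) r)"
    "lin s s3 K \<Longrightarrow> lin s s4 (\<lambda>x. T p q (K x))"
  using assms lin_comp[of s1 s4 "\<lambda>x. T x q r" s F] lin_comp[of s2 s4 "\<lambda>x. T p x r" s G]
    lin_comp[of s3 s4 "\<lambda>x. T p q x" s K]
  by (auto simp: trilin_def)

lemma lin_quadlin:
  assumes "quadlin s1 s2 s3 s4 s5 Q"
  shows "lin s s1 F \<Longrightarrow> lin s s5 (\<lambda>x. Q (F x) q r w)" "lin s s2 G \<Longrightarrow> lin s s5 (\<lambda>x. Q p (G x) r w)"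
    "lin s s3 K \<Longrightarrow> lin s s5 (\<lambda>x. Q p q (K x) w)" "lin s s4 L \<Longrightarrow> lin s s5 (\<lambda>x. Q p q r (L x))"
  using assms lin_comp[of s1 s5 "\<lambda>x. Q x q r w" s F] lin_comp[of s2 s5 "\<lambda>x. Q p x r w" s G]
    lin_comp[of s3 s5 "\<lambda>x. Q p q x w" s K] lin_comp[of s4 s5 "\<lambda>x. Q p q r x" s L]
  by (auto simp: quadlin_def)

section \<open>Sums over representatives\<close>

lemma ev2_empty [simp]: "ev2 B {#} = 0"
  and ev2_add_mset: "ev2 B (add_mset p M) = B (fst p) (snd p) + ev2 B M"
  by (auto simp: ev2_def split: prod.split)

lemma ev2_single [simp]: "ev2 B {#(a, b)#} = B a b"
  by (simp add: ev2_add_mset)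

lemma ev2_union: "ev2 B (M + N) = ev2 B M + ev2 B N"
  by (simp add: ev2_def)

lemma sum_image_collect:
  "(\<Sum>x\<in>#(\<Sum>y\<in>#M. G y). F x) = (\<Sum>y\<in>#M. \<Sum>x\<in>#G y. F x)"
  by (induction M) auto

text \<open>Multisets under union are themselves a commutative monoid, so \<open>ev2\<close> also
  builds representatives. Here the inner \<open>ev2\<close> is of this kind, and evaluating a formal
  sum of formal sums becomes iterated evaluation.\<close>

lemma ev2_ev2: "ev2 B (ev2 G M) = ev2 (\<lambda>a b. ev2 B (G a b)) M"
  by (induction M) (auto simp: ev2_add_mset ev2_union)

lemma ev2_sw2: "ev2 B (sw2 D x G) = sw2 D x (\<lambda>a b. ev2 B (G a b))"
  by (simp add: sw2_def ev2_ev2)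

lemma ev2_swap:
  "ev2 (\<lambda>a b. ev2 (\<lambda>c d. T a b c d) N) M = ev2 (\<lambda>c d. ev2 (\<lambda>a b. T a b c d) M) N"
  unfolding ev2_def case_prod_beta by (rule sum_mset.swap)

lemma sw2_swap:
  "sw2 D x (\<lambda>a b. sw2 E y (\<lambda>c d. T a b c d)) = sw2 E y (\<lambda>c d. sw2 D x (\<lambda>a b. T a b c d))"
  unfolding sw2_def by (rule ev2_swap)

lemma ev4_single [simp]: "ev4 Q {#(a, b, c, d)#} = Q a b c d"
  and ev3_single [simp]: "ev3 T {#(a, b, c)#} = T a b c"
  by (simp_all add: ev3_def ev4_def)

lemma ev4_ev2: "ev4 Q (ev2 G M) = ev2 (\<lambda>a b. ev4 Q (G a b)) M"
  unfolding ev2_def ev4_def sum_image_collect case_prod_unfold ..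

lemma ev4_ev4: "ev4 Q (ev4 K P) = ev4 (\<lambda>a b c d. ev4 Q (K a b c d)) P"
  unfolding ev4_def sum_image_collect case_prod_unfold ..

lemma ev3_ev2: "ev3 T (ev2 J M) = ev2 (\<lambda>a b. ev3 T (J a b)) M"
  unfolding ev2_def ev3_def sum_image_collect case_prod_unfold ..

lemma ev4_sw2: "ev4 Q (sw2 D x G) = sw2 D x (\<lambda>a b. ev4 Q (G a b))"
  and ev3_sw2: "ev3 T (sw2 D x J) = sw2 D x (\<lambda>a b. ev3 T (J a b))"
  by (simp_all add: sw2_def ev4_ev2 ev3_ev2)

lemma image_mset_conv_ev2: "image_mset F M = ev2 (\<lambda>p q. {#F (p, q)#}) M"
  by (induction M) (auto simp: ev2_add_mset)

lemma pair4_conv_ev2: "pair4 M N = ev2 (\<lambda>a h. ev2 (\<lambda>c g. {#(a, h, c, g)#}) N) M"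
  by (simp add: pair4_def ev2_def)

lemma cmR_conv_ev2: "cmR A H M = ev2 (cmT A H) M"
  and extR_conv_ev2: "extR \<Phi> M = ev2 \<Phi> M"
  and cuR_conv_ev2: "cuR A H M = ev2 (\<lambda>a h. cu A a * cu H h) M"
  and upm_conv_ev2: "upm A H lt rt f M N = ev2 (\<lambda>a h. ev2 (\<lambda>c g. upp A H lt rt f a h c g) N) M"
  and up4_conv_ev4: "up4 A H lt rt f P Q = ev4 (\<lambda>a h a' h'. ev4 (\<lambda>c g c' g'.
      pair4 (upp A H lt rt f a h c g) (upp A H lt rt f a' h' c' g')) Q) P"
  by (simp_all add: cmR_def extR_def cuR_def upm_def up4_def ev2_def ev4_def)

lemma ev4_pair4: "ev4 Q (pair4 M N) = ev2 (\<lambda>a h. ev2 (\<lambda>c g. Q a h c g) N) M"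
  by (simp add: pair4_conv_ev2 ev4_ev2)

lemma ev4_cmT: "ev4 Q (cmT A H a h) = sw2 (cm A) a (\<lambda>a1 a2. sw2 (cm H) h (\<lambda>h1 h2. Q a1 h1 a2 h2))"
  by (simp add: cmT_def ev4_sw2)

lemma lin_ev2: "lin s t \<phi> \<Longrightarrow> \<phi> (ev2 B M) = ev2 (\<lambda>a b. \<phi> (B a b)) M"
  by (induction M) (auto simp: ev2_add_mset linD)

lemma lin_sw2: "lin s t \<phi> \<Longrightarrow> \<phi> (sw2 D x B) = sw2 D x (\<lambda>a b. \<phi> (B a b))"
  unfolding sw2_def by (rule lin_ev2)

lemma lin_ev2_body:
  assumes "vector_space s" "vector_space t" "\<And>a b. lin s t (\<lambda>x. T x a b)"
  shows "lin s t (\<lambda>x. ev2 (\<lambda>a b. T x a b) M)"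
proof (induction M)
  case empty
  interpret vector_space_pair s t using assms by (intro vector_space_pair.intro)
  show ?case by (simp add: module_hom_zero)
next
  case (add p M)
  then show ?case by (simp add: ev2_add_mset lin_add assms)
qed

lemma lin_sw2_body:
  assumes "\<And>a b. lin s t (\<lambda>x. T x a b)"
  shows "lin s t (\<lambda>x. sw2 D y (\<lambda>a b. T x a b))"
  unfolding sw2_def using assms linD(1,2)[OF assms] by (intro lin_ev2_body)

lemma mult_sw2_left: "(c::'k::field) * sw2 D x B = sw2 D x (\<lambda>a b. c * B a b)"
  by (rule lin_sw2[OF lin_mult_left[OF lin_ident[OF vector_space_mult]]])

declare lin_sw2_body [lins]

section \<open>Coalgebras\<close>

lemma coalg_vs: "coalg V \<Longrightarrow> vector_space (sc V)"
  by (simp add: coalg_def)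

lemma lin_counit: "coalg V \<Longrightarrow> lin s (sc V) F \<Longrightarrow> lin s (*) (\<lambda>x. cu V (F x))"
  by (rule lin_comp) (auto simp: coalg_def)

text \<open>\<open>coalg\<close> gives linearity of the comultiplication against scalar-valued
  bilinear forms; composing with the forms on the target extends it to vector-valued
  \<open>B\<close>.\<close>

lemma lin_comult:
  fixes V :: "('k::field, 'v::ab_group_add) kstr" and t :: "'k \<Rightarrow> 't::ab_group_add \<Rightarrow> 't"
  assumes V: "coalg V" and F: "lin s (sc V) F"
    and B: "\<And>a. lin (sc V) t (\<lambda>b. B a b)" "\<And>b. lin (sc V) t (\<lambda>a. B a b)"
  shows "lin s t (\<lambda>x. sw2 (cm V) (F x) (\<lambda>a b. B a b))"
proof (rule lin_by_forms)
  show "vector_space s" "vector_space t" by (rule linD(1)[OF F] linD(2)[OF B(1)])+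
  fix \<phi> :: "'t \<Rightarrow> 'k" assume \<phi>: "lin t (*) \<phi>"
  have "bilin (sc V) (sc V) (*) (\<lambda>a b. \<phi> (B a b))"
    by (intro bilinI lin_comp[OF \<phi>] B)
  with V have "lin (sc V) (*) (\<lambda>x. sw2 (cm V) x (\<lambda>a b. \<phi> (B a b)))"
    by (simp add: coalg_def sw2_def)
  from lin_comp[OF this F] show "lin s (*) (\<lambda>x. \<phi> (sw2 (cm V) (F x) (\<lambda>a b. B a b)))"
    by (simp add: lin_sw2[OF \<phi>])
qed

text \<open>Coassociativity is postulated for scalar-valued trilinear forms, and forms on the target
  of \<open>T\<close> separate its points.\<close>

lemma sw2_coassoc:
  fixes V :: "('k::field, 'v::ab_group_add) kstr" and t :: "'k \<Rightarrow> 't::ab_group_add \<Rightarrow> 't"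
  assumes V: "coalg V" and T: "\<And>x y. lin (sc V) t (\<lambda>z. T x y z)"
    "\<And>x z. lin (sc V) t (\<lambda>y. T x y z)" "\<And>y z. lin (sc V) t (\<lambda>x. T x y z)"
  shows "sw2 (cm V) x (\<lambda>y z. sw2 (cm V) y (\<lambda>p q. T p q z))
       = sw2 (cm V) x (\<lambda>p w. sw2 (cm V) w (\<lambda>q z. T p q z))"
proof (rule lin_separates)
  show "vector_space t" by (rule linD(2)[OF T(1)])
  fix \<phi> :: "'t \<Rightarrow> 'k" assume \<phi>: "lin t (*) \<phi>"
  have "trilin (sc V) (sc V) (sc V) (*) (\<lambda>x y z. \<phi> (T x y z))"
    by (intro trilinI lin_comp[OF \<phi>] T)
  with V show "\<phi> (sw2 (cm V) x (\<lambda>y z. sw2 (cm V) y (\<lambda>p q. T p q z)))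
      = \<phi> (sw2 (cm V) x (\<lambda>p w. sw2 (cm V) w (\<lambda>q z. T p q z)))"
    unfolding coalg_def lin_sw2[OF \<phi>] by presburger
qed

lemma sw2_counit_left:
  assumes "coalg V" and \<phi>: "lin (sc V) t \<phi>"
  shows "sw2 (cm V) x (\<lambda>y z. t (cu V y) (\<phi> z)) = \<phi> x"
proof -
  have "\<phi> (sw2 (cm V) x (\<lambda>y z. sc V (cu V y) z)) = \<phi> x"
    using assms(1) unfolding coalg_def by presburger
  then show ?thesis by (simp add: lin_sw2[OF \<phi>] linD(4)[OF \<phi>])
qed

lemma sw2_counit_right:
  assumes "coalg V" and \<phi>: "lin (sc V) t \<phi>"
  shows "sw2 (cm V) x (\<lambda>y z. t (cu V z) (\<phi> y)) = \<phi> x"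
proof -
  have "\<phi> (sw2 (cm V) x (\<lambda>y z. sc V (cu V z) y)) = \<phi> x"
    using assms(1) unfolding coalg_def by presburger
  then show ?thesis by (simp add: lin_sw2[OF \<phi>] linD(4)[OF \<phi>])
qed

text \<open>Equality of tensors is defined by scalar-valued bilinear forms. It carries over to
  bilinear maps into any vector space because forms on the target separate points.\<close>

lemma teq2D:
  fixes s1 :: "'k::field \<Rightarrow> 'x::ab_group_add \<Rightarrow> 'x" and t :: "'k \<Rightarrow> 't::ab_group_add \<Rightarrow> 't"
  assumes "teq2 s1 s2 M N" and B: "\<And>x. lin s2 t (\<lambda>y. B x y)" "\<And>y. lin s1 t (\<lambda>x. B x y)"
  shows "ev2 B M = ev2 B N"
proof (rule lin_separates)
  show "vector_space t" by (rule linD(2)[OF B(1)])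
  fix \<phi> :: "'t \<Rightarrow> 'k" assume \<phi>: "lin t (*) \<phi>"
  have "bilin s1 s2 (*) (\<lambda>x y. \<phi> (B x y))"
    by (intro bilinI lin_comp[OF \<phi>] B)
  with assms(1) show "\<phi> (ev2 B M) = \<phi> (ev2 B N)"
    unfolding teq2_def lin_ev2[OF \<phi>] by blast
qed

text \<open>The Sweedler sum of the tensor product coalgebra \<open>V \<otimes> W\<close>.\<close>
definition swp :: "('k, 'v) kstr \<Rightarrow> ('k, 'w) kstr \<Rightarrow> 'v \<Rightarrow> 'w \<Rightarrow> ('v \<Rightarrow> 'w \<Rightarrow> 'v \<Rightarrow> 'w \<Rightarrow> 'c::comm_monoid_add) \<Rightarrow> 'c" where
  "swp V W v w T = sw2 (cm V) v (\<lambda>v1 v2. sw2 (cm W) w (\<lambda>w1 w2. T v1 w1 v2 w2))"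

lemma lin_swp: "lin s t \<phi> \<Longrightarrow> \<phi> (swp V W v w T) = swp V W v w (\<lambda>a b c d. \<phi> (T a b c d))"
  by (simp add: swp_def lin_sw2)

lemma lin_swp_body [lins]:
  assumes "\<And>a b c d. lin s t (\<lambda>x. T x a b c d)"
  shows "lin s t (\<lambda>x. swp V W v w (\<lambda>a b c d. T x a b c d))"
  unfolding swp_def using assms by (intro lin_sw2_body)

lemma lin_swp_fst:
  assumes "coalg V" "lin s (sc V) F"
    "\<And>b c d. lin (sc V) t (\<lambda>a. T a b c d)" "\<And>a b d. lin (sc V) t (\<lambda>c. T a b c d)"
  shows "lin s t (\<lambda>x. swp V W (F x) w (\<lambda>a b c d. T a b c d))"
  unfolding swp_def using assms by (intro lin_comult lins)

lemma lin_swp_snd: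
  assumes "coalg W" "lin s (sc W) F"
    "\<And>a c d. lin (sc W) t (\<lambda>b. T a b c d)" "\<And>a b c. lin (sc W) t (\<lambda>d. T a b c d)"
  shows "lin s t (\<lambda>x. swp V W v (F x) (\<lambda>a b c d. T a b c d))"
  unfolding swp_def using assms by (intro lins lin_comult)

text \<open>After the sums over the two factors are interchanged, this is coassociativity of
  \<open>W\<close> followed by coassociativity of \<open>V\<close>.\<close>

lemma swp_coassoc:
  fixes V :: "('k::field, 'v::ab_group_add) kstr" and W :: "('k, 'w::ab_group_add) kstr"
  assumes V: "coalg V" and W: "coalg W"
    and T: "\<And>q r s t y. lin (sc V) t0 (\<lambda>p. T p q r s t y)"
      "\<And>p r s t y. lin (sc W) t0 (\<lambda>q. T p q r s t y)"
      "\<And>p q s t y. lin (sc V) t0 (\<lambda>r. T p q r s t y)"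
      "\<And>p q r t y. lin (sc W) t0 (\<lambda>s. T p q r s t y)"
      "\<And>p q r s y. lin (sc V) t0 (\<lambda>t. T p q r s t y)"
      "\<And>p q r s t. lin (sc W) t0 (\<lambda>y. T p q r s t y)"
  shows "swp V W v w (\<lambda>v1 w1 v2 w2. swp V W v1 w1 (\<lambda>p q r s. T p q r s v2 w2))
       = swp V W v w (\<lambda>v1 w1 v2 w2. swp V W v2 w2 (\<lambda>r s t y. T v1 w1 r s t y))"
proof -
  have "swp V W v w (\<lambda>v1 w1 v2 w2. swp V W v1 w1 (\<lambda>p q r s. T p q r s v2 w2))
      = sw2 (cm V) v (\<lambda>v1 v2. sw2 (cm V) v1 (\<lambda>p r. sw2 (cm W) w (\<lambda>w1 w2. sw2 (cm W) w1 (\<lambda>q s. T p q r s v2 w2))))"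
    unfolding swp_def by (subst sw2_swap[of "cm W" w]) rule
  also have "\<dots> = sw2 (cm V) v (\<lambda>v1 v2. sw2 (cm V) v1 (\<lambda>p r. sw2 (cm W) w (\<lambda>q w'. sw2 (cm W) w' (\<lambda>s w2. T p q r s v2 w2))))"
    by (subst sw2_coassoc[OF W]) (rule T refl)+
  also have "\<dots> = sw2 (cm V) v (\<lambda>p v'. sw2 (cm V) v' (\<lambda>r t. sw2 (cm W) w (\<lambda>q w'. sw2 (cm W) w' (\<lambda>s w2. T p q r s t w2))))"
    by (rule sw2_coassoc[OF V, where t = t0]) (intro lins T)+
  also have "\<dots> = swp V W v w (\<lambda>v1 w1 v2 w2. swp V W v2 w2 (\<lambda>r s t y. T v1 w1 r s t y))"
    unfolding swp_def by (subst sw2_swap[of "cm W" w]) rule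
  finally show ?thesis .
qed

lemma swp_counit_left:
  assumes V: "coalg V" and W: "coalg W" and X: "bilin (sc V) (sc W) t X"
  shows "swp V W v w (\<lambda>v1 w1 v2 w2. t (cu V v1 * cu W w1) (X v2 w2)) = X v w"
proof -
  interpret vector_space t using bilinD(3)[OF X] .
  have "swp V W v w (\<lambda>v1 w1 v2 w2. t (cu V v1 * cu W w1) (X v2 w2))
      = sw2 (cm V) v (\<lambda>v1 v2. t (cu V v1) (sw2 (cm W) w (\<lambda>w1 w2. t (cu W w1) (X v2 w2))))"
    by (simp add: swp_def lin_sw2[OF lin_scale_right[OF lin_ident]] vector_space_axioms)
  also have "\<dots> = sw2 (cm V) v (\<lambda>v1 v2. t (cu V v1) (X v2 w))"
    by (subst sw2_counit_left[OF W]) (rule lin_bilin[OF X] lin_ident coalg_vs W refl)+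
  also have "\<dots> = X v w"
    by (rule sw2_counit_left[OF V]) (rule lin_bilin[OF X] lin_ident coalg_vs V refl)+
  finally show ?thesis .
qed

lemma swp_counit_right:
  assumes V: "coalg V" and W: "coalg W" and X: "bilin (sc V) (sc W) t X"
  shows "swp V W v w (\<lambda>v1 w1 v2 w2. t (cu V v2 * cu W w2) (X v1 w1)) = X v w"
proof -
  interpret vector_space t using bilinD(3)[OF X] .
  have "swp V W v w (\<lambda>v1 w1 v2 w2. t (cu V v2 * cu W w2) (X v1 w1))
      = sw2 (cm V) v (\<lambda>v1 v2. t (cu V v2) (sw2 (cm W) w (\<lambda>w1 w2. t (cu W w2) (X v1 w1))))"
    by (simp add: swp_def lin_sw2[OF lin_scale_right[OF lin_ident]] vector_space_axioms)
  also have "\<dots> = sw2 (cm V) v (\<lambda>v1 v2. t (cu V v2) (X v1 w))"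
    by (subst sw2_counit_right[OF W]) (rule lin_bilin[OF X] lin_ident coalg_vs W refl)+
  also have "\<dots> = X v w"
    by (rule sw2_counit_right[OF V]) (rule lin_bilin[OF X] lin_ident coalg_vs V refl)+
  finally show ?thesis .
qed

section \<open>Coalgebra maps on a tensor product of two coalgebras\<close>

lemma cmap2_bilin: "cmap2 V W U B \<Longrightarrow> bilin (sc V) (sc W) (sc U) B"
  and cmap2_counit: "cmap2 V W U B \<Longrightarrow> cu U (B x y) = cu V x * cu W y"
  by (auto simp: cmap2_def)

lemma cmap2_comult:
  assumes B: "cmap2 V W U B" and \<beta>: "bilin (sc U) (sc U) t \<beta>"
  shows "sw2 (cm U) (B x y) (\<lambda>a b. \<beta> a b) = swp V W x y (\<lambda>x1 y1 x2 y2. \<beta> (B x1 y1) (B x2 y2))"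
proof -
  have "teq2 (sc U) (sc U) (cm U (B x y))
      (sw2 (cm V) x (\<lambda>x1 x2. sw2 (cm W) y (\<lambda>y1 y2. {#(B x1 y1, B x2 y2)#})))"
    using B by (auto simp: cmap2_def)
  from teq2D[OF this, of t \<beta>] \<beta> show ?thesis
    by (simp add: bilin_def ev2_sw2 swp_def sw2_def[of "cm U"])
qed

lemma cmap2I:
  fixes U :: "('k::field, 'u::ab_group_add) kstr"
  assumes "bilin (sc V) (sc W) (sc U) B"
    and "\<And>x y. cu U (B x y) = cu V x * cu W y"
    and "\<And>\<beta> x y. bilin (sc U) (sc U) ((*) :: 'k \<Rightarrow> 'k \<Rightarrow> 'k) \<beta> \<Longrightarrow>
      sw2 (cm U) (B x y) \<beta> = swp V W x y (\<lambda>x1 y1 x2 y2. \<beta> (B x1 y1) (B x2 y2))"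
  shows "cmap2 V W U B"
  using assms by (simp add: cmap2_def teq2_def ev2_sw2 swp_def sw2_def[of "cm U"])

section \<open>Convolution\<close>

locale hopf =
  fixes A :: "('k::field, 'a::ab_group_add) kstr" and SA :: "'a \<Rightarrow> 'a"
  assumes hopf: "hopf_alg A SA"
begin

lemma coalg_A: "coalg A"
  using hopf by (simp add: hopf_alg_def bialg_def)

lemma vs_A: "vector_space (sc A)"
  by (rule coalg_vs[OF coalg_A])

lemma bilin_mul: "bilin (sc A) (sc A) (sc A) (mul A)"
  using hopf by (simp add: hopf_alg_def bialg_def kalgebra_def)

lemma mul_assoc: "mul A (mul A a b) c = mul A a (mul A b c)"
  and mul_one [simp]: "mul A (one A) a = a" "mul A a (one A) = a"
  using hopf by (simp_all add: hopf_alg_def bialg_def kalgebra_def)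

lemma counit_mul: "cu A (mul A a b) = cu A a * cu A b"
  and counit_one [simp]: "cu A (one A) = 1"
  using hopf by (simp_all add: hopf_alg_def bialg_def)

lemmas lin_mul [lins] = lin_bilin[OF bilin_mul]
lemmas lin_cuA [lins] = lin_counit[OF coalg_A]

lemma lin_S: "lin (sc A) (sc A) SA"
  using hopf by (simp add: hopf_alg_def)

lemmas lin_S' [lins] = lin_comp[OF lin_S]

lemma comult_mul:
  assumes "\<And>x. lin (sc A) t (\<lambda>y. B x y)" "\<And>y. lin (sc A) t (\<lambda>x. B x y)"
  shows "sw2 (cm A) (mul A a b) (\<lambda>x y. B x y) = swp A A a b (\<lambda>a1 b1 a2 b2. B (mul A a1 b1) (mul A a2 b2))"
proof -
  have "teq2 (sc A) (sc A) (cm A (mul A a b))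
              (sw2 (cm A) a (\<lambda>a1 a2. sw2 (cm A) b (\<lambda>b1 b2. {#(mul A a1 b1, mul A a2 b2)#})))"
    using hopf by (simp add: hopf_alg_def bialg_def)
  from teq2D[OF this, of t B] assms show ?thesis
    by (simp add: ev2_sw2 swp_def sw2_def[of "cm A" "mul A a b"])
qed

lemma comult_one:
  assumes "\<And>x. lin (sc A) t (\<lambda>y. B x y)" "\<And>y. lin (sc A) t (\<lambda>x. B x y)"
  shows "sw2 (cm A) (one A) (\<lambda>x y. B x y) = B (one A) (one A)"
proof -
  have "teq2 (sc A) (sc A) (cm A (one A)) {#(one A, one A)#}"
    using hopf by (simp add: hopf_alg_def bialg_def)
  from teq2D[OF this, of t B] assms show ?thesis
    by (simp add: ev2_sw2 swp_def sw2_def[of "cm A"])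
qed

lemma antipode_left: "sw2 (cm A) a (\<lambda>x y. mul A (SA x) y) = sc A (cu A a) (one A)"
  and antipode_right: "sw2 (cm A) a (\<lambda>x y. mul A x (SA y)) = sc A (cu A a) (one A)"
  using hopf by (simp_all add: hopf_alg_def)

lemma mul_swp_right: "mul A c (swp V W v w T) = swp V W v w (\<lambda>p q r s. mul A c (T p q r s))"
  by (rule lin_swp[OF lin_bilin2[OF bilin_mul lin_ident[OF vs_A]]])

lemma mul_sw2_left: "mul A (sw2 D x T) c = sw2 D x (\<lambda>p q. mul A (T p q) c)"
  by (rule lin_sw2[OF lin_bilin1[OF bilin_mul lin_ident[OF vs_A]]])

lemma mul_sw2_right: "mul A c (sw2 D x T) = sw2 D x (\<lambda>p q. mul A c (T p q))"
  by (rule lin_sw2[OF lin_bilin2[OF bilin_mul lin_ident[OF vs_A]]])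

lemma mul_scale: "mul A (sc A r a) b = sc A r (mul A a b)" "mul A a (sc A r b) = sc A r (mul A a b)"
  using bilinD(4,5)[OF bilin_mul] by auto

text \<open>The convolution product of linear maps from the coalgebra \<open>V \<otimes> W\<close>
  to the algebra \<open>A\<close>, written for bilinear maps.\<close>

definition pconv :: "('k, 'v) kstr \<Rightarrow> ('k, 'w) kstr \<Rightarrow> ('v \<Rightarrow> 'w \<Rightarrow> 'a) \<Rightarrow> ('v \<Rightarrow> 'w \<Rightarrow> 'a) \<Rightarrow> 'v \<Rightarrow> 'w \<Rightarrow> 'a" where
  "pconv V W X Y v w = swp V W v w (\<lambda>v1 w1 v2 w2. mul A (X v1 w1) (Y v2 w2))"

context
  fixes V :: "('k, 'v::ab_group_add) kstr" and W :: "('k, 'w::ab_group_add) kstr"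
  assumes V: "coalg V" and W: "coalg W"
begin

lemma bilin_pconv:
  assumes X: "bilin (sc V) (sc W) (sc A) X" and Y: "bilin (sc V) (sc W) (sc A) Y"
  shows "bilin (sc V) (sc W) (sc A) (pconv V W X Y)"
  unfolding pconv_def
  by (intro bilinI lin_swp_fst[OF V] lin_swp_snd[OF W] lins lin_bilin[OF X] lin_bilin[OF Y]
      lin_ident coalg_vs V W)

text \<open>Coassociativity of \<open>V \<otimes> W\<close>, applied underneath
  \<open>\<beta>\<close>. With \<open>mul A\<close> in place of \<open>\<beta>\<close> it yields
  associativity of convolution; with general \<open>\<beta>\<close> it expands tensors whose first
  factor is a convolution product.\<close>

lemma pconv_tensor:
  assumes X: "bilin (sc V) (sc W) (sc A) X" and Y: "bilin (sc V) (sc W) (sc A) Y"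
    and Q: "bilin (sc V) (sc W) s Q" and \<beta>: "bilin (sc A) s t \<beta>"
  shows "swp V W v w (\<lambda>v1 w1 v2 w2. \<beta> (pconv V W X Y v1 w1) (Q v2 w2))
    = swp V W v w (\<lambda>v1 w1 v2 w2. swp V W v2 w2 (\<lambda>v2 w2 v3 w3. \<beta> (mul A (X v1 w1) (Y v2 w2)) (Q v3 w3)))"
  unfolding pconv_def lin_swp[OF lin_bilin1[OF \<beta> lin_ident[OF vs_A]]]
  by (rule swp_coassoc[OF V W, where ?t0.0 = t])
    (intro lins lin_bilin[OF X] lin_bilin[OF Y] lin_bilin[OF Q] lin_bilin[OF \<beta>] lin_ident coalg_vs V W)+

lemma pconv_assoc:
  assumes X: "bilin (sc V) (sc W) (sc A) X" and Y: "bilin (sc V) (sc W) (sc A) Y"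
    and Z: "bilin (sc V) (sc W) (sc A) Z"
  shows "pconv V W (pconv V W X Y) Z = pconv V W X (pconv V W Y Z)"
proof (intro ext)
  fix v w
  have "pconv V W (pconv V W X Y) Z v w
      = swp V W v w (\<lambda>v1 w1 v2 w2. mul A (pconv V W X Y v1 w1) (Z v2 w2))"
    by (rule pconv_def)
  also have "\<dots> = pconv V W X (pconv V W Y Z) v w"
    unfolding pconv_tensor[OF X Y Z bilin_mul] by (simp add: pconv_def mul_swp_right mul_assoc)
  finally show "pconv V W (pconv V W X Y) Z v w = pconv V W X (pconv V W Y Z) v w" .
qed

lemma pconv_counit_right:
  assumes X: "bilin (sc V) (sc W) (sc A) X"
  shows "pconv V W X (\<lambda>v w. sc A (cu V v * cu W w) (one A)) = X"
  by (intro ext) (simp add: pconv_def mul_scale swp_counit_right[OF V W X])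

text \<open>As \<open>Q\<close> is a coalgebra map, each convolution product is an antipode sum for
  the element \<open>Q v w\<close>. Hence \<open>SA \<circ> Q\<close> is the two-sided convolution
  inverse of \<open>Q\<close>.\<close>

lemma pconv_antipode:
  assumes Q: "cmap2 V W A Q"
  shows "pconv V W Q (\<lambda>v w. SA (Q v w)) = (\<lambda>v w. sc A (cu V v * cu W w) (one A))"
    and "pconv V W (\<lambda>v w. SA (Q v w)) Q = (\<lambda>v w. sc A (cu V v * cu W w) (one A))"
proof -
  have "pconv V W Q (\<lambda>v w. SA (Q v w)) v w = sw2 (cm A) (Q v w) (\<lambda>x y. mul A x (SA y))" for v w
    unfolding pconv_def
    by (rule cmap2_comult[OF Q, where t = "sc A", symmetric]) (intro bilinI lins lin_ident vs_A)
  then show "pconv V W Q (\<lambda>v w. SA (Q v w)) = (\<lambda>v w. sc A (cu V v * cu W w) (one A))"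
    by (simp add: antipode_right cmap2_counit[OF Q] fun_eq_iff)
  have "pconv V W (\<lambda>v w. SA (Q v w)) Q v w = sw2 (cm A) (Q v w) (\<lambda>x y. mul A (SA x) y)" for v w
    unfolding pconv_def
    by (rule cmap2_comult[OF Q, where t = "sc A", symmetric]) (intro bilinI lins lin_ident vs_A)
  then show "pconv V W (\<lambda>v w. SA (Q v w)) Q = (\<lambda>v w. sc A (cu V v * cu W w) (one A))"
    by (simp add: antipode_left cmap2_counit[OF Q] fun_eq_iff)
qed

text \<open>Convolve on the right with \<open>SA \<circ> Q\<close> or with \<open>Q\<close>. This
  passes between the equations produced by multiplicativity and the explicit formulas (i) and
  (ii).\<close>

lemma pconv_cancel:
  assumes X: "bilin (sc V) (sc W) (sc A) X" and Y: "bilin (sc V) (sc W) (sc A) Y"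
    and Q: "cmap2 V W A Q"
  shows "pconv V W X Q = Y \<longleftrightarrow> X = pconv V W Y (\<lambda>v w. SA (Q v w))"
proof -
  note Q' = cmap2_bilin[OF Q]
  have SQ: "bilin (sc V) (sc W) (sc A) (\<lambda>v w. SA (Q v w))"
    by (intro bilinI lins lin_bilin[OF Q'] lin_ident coalg_vs V W)
  show ?thesis
    using pconv_assoc[OF X Q' SQ] pconv_assoc[OF Y SQ Q'] pconv_antipode[OF Q]
      pconv_counit_right[OF X] pconv_counit_right[OF Y] by auto
qed

text \<open>The counit of \<open>A\<close> is multiplicative, so it turns the convolution into a sum
  of counits, which the counit axiom of \<open>V \<otimes> W\<close> collapses.\<close>

lemma counit_pconv:
  assumes X: "bilin (sc V) (sc W) (sc A) X" "\<And>v w. cu A (X v w) = cu V v * cu W w"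
    and Y: "bilin (sc V) (sc W) (sc A) Y" "\<And>v w. cu A (Y v w) = cu V v * cu W w"
  shows "cu A (pconv V W X Y v w) = cu V v * cu W w"
proof -
  have "bilin (sc V) (sc W) (*) (\<lambda>v w. cu V v * cu W w)"
    by (intro bilinI lins lin_counit lin_ident coalg_vs V W)
  from swp_counit_left[OF V W this] show ?thesis
    unfolding pconv_def lin_swp[OF lin_cuA[OF lin_ident[OF vs_A]]]
    by (simp add: counit_mul X Y)
qed

text \<open>Testing against \<open>\<epsilon> \<otimes> \<phi>\<close> and \<open>\<phi> \<otimes> \<epsilon>\<close> recovers both factors of \<open>P \<otimes> Q\<close>.\<close>
lemma tensor_cancel:
  fixes U :: "('k, 'u::ab_group_add) kstr"
  assumes U: "coalg U"
    and P: "bilin (sc V) (sc W) (sc A) P" "\<And>v w. cu A (P v w) = cu V v * cu W w"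
    and P': "bilin (sc V) (sc W) (sc A) P'" "\<And>v w. cu A (P' v w) = cu V v * cu W w"
    and Q: "bilin (sc V) (sc W) (sc U) Q" "\<And>v w. cu U (Q v w) = cu V v * cu W w"
    and Q': "bilin (sc V) (sc W) (sc U) Q'" "\<And>v w. cu U (Q' v w) = cu V v * cu W w"
  shows "(\<forall>\<beta> v w. bilin (sc A) (sc U) ((*) :: 'k \<Rightarrow> 'k \<Rightarrow> 'k) \<beta> \<longrightarrow>
      swp V W v w (\<lambda>v1 w1 v2 w2. \<beta> (P v1 w1) (Q v2 w2)) = swp V W v w (\<lambda>v1 w1 v2 w2. \<beta> (P' v1 w1) (Q' v2 w2)))
    \<longleftrightarrow> P = P' \<and> Q = Q'" (is "?L \<longleftrightarrow> ?R")
proof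
  assume L: ?L
  have "Q v w = Q' v w" for v w
  proof (rule lin_separates[OF coalg_vs[OF U]])
    fix \<phi> :: "'u \<Rightarrow> 'k" assume \<phi>: "lin (sc U) (*) \<phi>"
    have "bilin (sc A) (sc U) (*) (\<lambda>x y. cu A x * \<phi> y)"
      by (intro bilinI lins lin_comp[OF \<phi>] lin_ident vs_A coalg_vs U)
    note L[rule_format, OF this, of v w]
    moreover have "bilin (sc V) (sc W) (*) (\<lambda>v w. \<phi> (Q v w))" "bilin (sc V) (sc W) (*) (\<lambda>v w. \<phi> (Q' v w))"
      by (intro bilinI lin_comp[OF \<phi>] lin_bilin[OF Q(1)] lin_bilin[OF Q'(1)] lin_ident coalg_vs V W)+
    note this[THEN swp_counit_left[OF V W]]
    ultimately show "\<phi> (Q v w) = \<phi> (Q' v w)" by (simp add: P P')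
  qed
  moreover have "P v w = P' v w" for v w
  proof (rule lin_separates[OF vs_A])
    fix \<phi> :: "'a \<Rightarrow> 'k" assume \<phi>: "lin (sc A) (*) \<phi>"
    have "bilin (sc A) (sc U) (*) (\<lambda>x y. cu U y * \<phi> x)"
      by (intro bilinI lins lin_comp[OF \<phi>] lin_counit lin_ident vs_A coalg_vs U)
    note L[rule_format, OF this, of v w]
    moreover have "bilin (sc V) (sc W) (*) (\<lambda>v w. \<phi> (P v w))" "bilin (sc V) (sc W) (*) (\<lambda>v w. \<phi> (P' v w))"
      by (intro bilinI lin_comp[OF \<phi>] lin_bilin[OF P(1)] lin_bilin[OF P'(1)] lin_ident coalg_vs V W)+
    note this[THEN swp_counit_right[OF V W]]
    ultimately show "\<phi> (P v w) = \<phi> (P' v w)" by (simp add: Q Q')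
  qed
  ultimately show ?R by (intro conjI ext)
qed auto

end

end

section \<open>Unified products\<close>

text \<open>The multiplication \<open>m\<close> is a parameter separate from the record
  \<open>H\<close>, so that the two structures to be compared are instances over the same
  \<open>H\<close> and share its coalgebra part literally.\<close>

locale ext_hopf = hopf A SA for A :: "('k::field, 'a::ab_group_add) kstr" and SA +
  fixes H :: "('k, 'h::ab_group_add) kstr" and m :: "'h \<Rightarrow> 'h \<Rightarrow> 'h"
    and lt :: "'h \<Rightarrow> 'a \<Rightarrow> 'h" and rt :: "'h \<Rightarrow> 'a \<Rightarrow> 'a" and f :: "'h \<Rightarrow> 'h \<Rightarrow> 'a"
  assumes hopf_ext: "hopf_ext A (H\<lparr>mul := m\<rparr>) lt rt f"
begin

lemma coalg_H: "coalg H"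
  using hopf_ext by (simp add: hopf_ext_def ext_datum_def coalg_def)

lemma vs_H: "vector_space (sc H)"
  by (rule coalg_vs[OF coalg_H])

lemma cmap_lt: "cmap2 H A H lt" and cmap_rt: "cmap2 H A A rt" and cmap_f: "cmap2 H H A f"
  using hopf_ext by (simp_all add: hopf_ext_def ext_datum_def cmap2_def)

lemma bilin_m: "bilin (sc H) (sc H) (sc H) m"
  using hopf_ext by (simp add: hopf_ext_def ext_datum_def)

lemma m_one [simp]: "m (one H) h = h" "m h (one H) = h"
  and rt_one: "rt h (one A) = sc A (cu H h) (one A)" and one_rt [simp]: "rt (one H) a = a"
  and one_lt: "lt (one H) a = sc H (cu A a) (one H)" and lt_one [simp]: "lt h (one A) = h"
  and f_one: "f h (one H) = sc A (cu H h) (one A)" and one_f: "f (one H) h = sc A (cu H h) (one A)"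
  using hopf_ext by (simp_all add: hopf_ext_def ext_datum_def)

lemmas counit_lt = cmap2_counit[OF cmap_lt]
lemmas counit_rt = cmap2_counit[OF cmap_rt]
lemmas counit_f = cmap2_counit[OF cmap_f]
lemmas lin_cuH [lins] = lin_counit[OF coalg_H]
lemmas lin_lt [lins] = lin_bilin[OF cmap2_bilin[OF cmap_lt]]
lemmas lin_rt [lins] = lin_bilin[OF cmap2_bilin[OF cmap_rt]]
lemmas lin_f [lins] = lin_bilin[OF cmap2_bilin[OF cmap_f]]
lemmas lin_m [lins] = lin_bilin[OF bilin_m]
lemmas lin_id [lins] = lin_ident[OF vs_A] lin_ident[OF vs_H]

text \<open>Read off from the value \<open>1\<close> of the counit at the unit of the unified
  product, as \<open>cu A (one A) = 1\<close>.\<close>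

lemma counit_one_H [simp]: "cu H (one H) = 1"
  using hopf_ext by (simp add: hopf_ext_def unified_hopf_def cuR_conv_ev2)

lemma comult_one_H:
  assumes "\<And>x. lin (sc H) t (\<lambda>y. B x y)" "\<And>y. lin (sc H) t (\<lambda>x. B x y)"
  shows "sw2 (cm H) (one H) (\<lambda>x y. B x y) = B (one H) (one H)"
proof -
  have "teq2 (sc H) (sc H) (cm H (one H)) {#(one H, one H)#}"
    using hopf_ext by (simp add: hopf_ext_def ext_datum_def)
  from teq2D[OF this, of t B] assms show ?thesis
    by (simp add: sw2_def)
qed

text \<open>The forms \<open>fm \<beta> h g\<close> and \<open>up \<beta> a h c g\<close> are the values of \<open>\<beta>\<close> on \<open>(1 \<ltimes> h) \<bullet> (1 \<ltimes> g)\<close> and on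
  \<open>(a \<ltimes> h) \<bullet> (c \<ltimes> g)\<close>.\<close>
definition fm :: "('a \<Rightarrow> 'h \<Rightarrow> 'c::ab_group_add) \<Rightarrow> 'h \<Rightarrow> 'h \<Rightarrow> 'c" where
  "fm \<beta> h g = swp H H h g (\<lambda>h1 g1 h2 g2. \<beta> (f h1 g1) (m h2 g2))"

definition up :: "('a \<Rightarrow> 'h \<Rightarrow> 'c::ab_group_add) \<Rightarrow> 'a \<Rightarrow> 'h \<Rightarrow> 'a \<Rightarrow> 'h \<Rightarrow> 'c" where
  "up \<beta> a h c g = swp H A h c (\<lambda>h1 c1 h2 c2. fm (\<lambda>p q. \<beta> (mul A a (mul A (rt h1 c1) p)) q) (lt h2 c2) g)"

lemma lin_fm_body [lins]: "(\<And>p q. lin s t (\<lambda>x. T x p q)) \<Longrightarrow> lin s t (\<lambda>x. fm (\<lambda>p q. T x p q) h g)"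
  unfolding fm_def by (intro lins)

lemma lin_up_body [lins]: "(\<And>p q. lin s t (\<lambda>x. T x p q)) \<Longrightarrow> lin s t (\<lambda>x. up (\<lambda>p q. T x p q) a h c g)"
  unfolding up_def by (intro lins)

context
  fixes \<beta> :: "'a \<Rightarrow> 'h \<Rightarrow> 'c::ab_group_add" and t
  assumes \<beta>: "\<And>p. lin (sc H) t (\<lambda>q. \<beta> p q)" "\<And>q. lin (sc A) t (\<lambda>p. \<beta> p q)"
begin

private lemma \<beta>_bilin: "bilin (sc A) (sc H) t \<beta>"
  by (intro bilinI \<beta>)

lemma lin_fm:
  "lin s (sc H) F \<Longrightarrow> lin s t (\<lambda>x. fm (\<lambda>p q. \<beta> p q) (F x) g)"
  "lin s (sc H) F \<Longrightarrow> lin s t (\<lambda>x. fm (\<lambda>p q. \<beta> p q) h (F x))"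
  unfolding fm_def
  by (intro lin_swp_fst[OF coalg_H] lin_swp_snd[OF coalg_H] lin_bilin[OF \<beta>_bilin] lins | assumption)+

text \<open>The unit \<open>one H\<close> is grouplike and \<open>f\<close> takes a counit multiple
  of \<open>one A\<close> when one argument is \<open>one H\<close>, so the counit axiom removes the
  remaining split of \<open>h\<close>.\<close>

lemma fm_one: "fm \<beta> h (one H) = \<beta> (one A) h" "fm \<beta> (one H) h = \<beta> (one A) h"
proof -
  have "fm \<beta> h (one H) = sw2 (cm H) h (\<lambda>h1 h2. \<beta> (f h1 (one H)) (m h2 (one H)))"
    unfolding fm_def swp_def
    by (subst comult_one_H[where t = t]) (rule lin_bilin[OF \<beta>_bilin] lins refl)+
  also have "\<dots> = \<beta> (one A) h"
    by (simp add: f_one bilinD(4)[OF \<beta>_bilin] sw2_counit_left[OF coalg_H \<beta>(1)])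
  finally show "fm \<beta> h (one H) = \<beta> (one A) h" .
  have "fm \<beta> (one H) h = sw2 (cm H) h (\<lambda>h1 h2. \<beta> (f (one H) h1) (m (one H) h2))"
    unfolding fm_def swp_def
    by (rule comult_one_H[where t = t]) (rule lin_bilin[OF \<beta>_bilin] lins refl)+
  also have "\<dots> = \<beta> (one A) h"
    by (simp add: one_f bilinD(4)[OF \<beta>_bilin] sw2_counit_left[OF coalg_H \<beta>(1)])
  finally show "fm \<beta> (one H) h = \<beta> (one A) h" .
qed

end

text \<open>A fresh context, in which the preceding lemmas are available for other forms as well,
  such as \<open>\<lambda>p q. \<beta> (mul A a p) q\<close>.\<close>

context
  fixes \<beta> :: "'a \<Rightarrow> 'h \<Rightarrow> 'c::ab_group_add" and t
  assumes \<beta>: "\<And>p. lin (sc H) t (\<lambda>q. \<beta> p q)" "\<And>q. lin (sc A) t (\<lambda>p. \<beta> p q)"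
begin

private lemma form_bilin: "bilin (sc A) (sc H) t \<beta>"
  by (intro bilinI \<beta>)

lemma lin_up:
  "lin s (sc A) K \<Longrightarrow> lin s t (\<lambda>x. up (\<lambda>p q. \<beta> p q) (K x) h c g)"
  "lin s (sc H) F \<Longrightarrow> lin s t (\<lambda>x. up (\<lambda>p q. \<beta> p q) a (F x) c g)"
  "lin s (sc A) K \<Longrightarrow> lin s t (\<lambda>x. up (\<lambda>p q. \<beta> p q) a h (K x) g)"
  "lin s (sc H) F \<Longrightarrow> lin s t (\<lambda>x. up (\<lambda>p q. \<beta> p q) a h c (F x))"
  unfolding up_def
  by (intro lin_swp_fst[OF coalg_H] lin_swp_snd[OF coalg_A] lin_fm lin_bilin[OF form_bilin] lins | assumption)+

text \<open>The element \<open>one A\<close> is grouplike, \<open>rt h (one A)\<close> is a counit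
  multiple of \<open>one A\<close> and \<open>lt h (one A) = h\<close>; the counit axiom then
  collapses the sum over \<open>h\<close>.\<close>

lemma up_one_one: "up \<beta> (one A) h (one A) g = fm \<beta> h g"
proof -
  have "up \<beta> (one A) h (one A) g = sw2 (cm H) h (\<lambda>h1 h2. fm (\<lambda>p q. \<beta> (mul A (rt h1 (one A)) p) q) h2 g)"
    unfolding up_def swp_def mul_one
    by (subst comult_one[where t = t]) (rule lin_fm lin_bilin[OF form_bilin] lins | simp)+
  also have "\<dots> = sw2 (cm H) h (\<lambda>h1 h2. t (cu H h1) (fm \<beta> h2 g))"
    unfolding fm_def lin_swp[OF lin_scale_right[OF lin_ident[OF bilinD(3)[OF form_bilin]]]]
    by (simp add: rt_one mul_scale bilinD(4)[OF form_bilin])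
  also have "\<dots> = fm \<beta> h g"
    by (rule sw2_counit_left[OF coalg_H]) (rule lin_fm \<beta> lins)+
  finally show ?thesis .
qed

text \<open>On \<open>one H\<close> the map \<open>rt\<close> is the identity and \<open>lt\<close>
  is a counit multiple of \<open>one H\<close>. Together with \<open>fm_one\<close> and the counit
  axiom this gives
  \<open>(a \<ltimes> 1) \<bullet> (c \<ltimes> g) = a c \<ltimes> g\<close>.\<close>

lemma up_one_H: "up \<beta> a (one H) c g = \<beta> (mul A a c) g"
proof -
  have "up \<beta> a (one H) c g = sw2 (cm A) c (\<lambda>c1 c2. fm (\<lambda>p q. \<beta> (mul A a (mul A c1 p)) q) (sc H (cu A c2) (one H)) g)"
    unfolding up_def swp_def
    by (subst comult_one_H[where t = t]) (rule lin_fm lin_bilin[OF form_bilin] lins | simp add: one_lt)+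
  also have "\<dots> = sw2 (cm A) c (\<lambda>c1 c2. t (cu A c2) (fm (\<lambda>p q. \<beta> (mul A a (mul A c1 p)) q) (one H) g))"
    by (subst linD(4)[where t = t and s = "sc H" and F = "\<lambda>h. fm _ h g"]) (rule lin_fm lin_bilin[OF form_bilin] lins refl)+
  also have "\<dots> = sw2 (cm A) c (\<lambda>c1 c2. t (cu A c2) (\<beta> (mul A a c1) g))"
    by (subst fm_one(2)[where t = t]) (rule lin_bilin[OF form_bilin] lins | simp)+
  also have "\<dots> = \<beta> (mul A a c) g"
    by (rule sw2_counit_right[OF coalg_A]) (rule lin_bilin[OF form_bilin] lins)+
  finally show ?thesis .
qed

lemma up_one_right:
  "up \<beta> a h c (one H) = swp H A h c (\<lambda>h1 c1 h2 c2. \<beta> (mul A a (rt h1 c1)) (lt h2 c2))"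
  unfolding up_def by (subst fm_one(1)[where t = t]) (rule lin_bilin[OF form_bilin] lins | simp)+

text \<open>\<open>up\<close> first forms \<open>h\<^sub>2 \<triangleleft> c\<^sub>2\<close> and
  lets \<open>fm\<close> comultiply it. Since \<open>lt\<close> is a coalgebra map, this amounts to
  splitting \<open>h\<^sub>2\<close> and \<open>c\<^sub>2\<close> once more, as in the defining
  formula of the product.\<close>

lemma up_eq_sw2:
  "up \<beta> a h c g = sw2 (cm H) h (\<lambda>h1 h'. sw2 (cm H) h' (\<lambda>h2 h3. sw2 (cm A) c (\<lambda>c1 c'. sw2 (cm A) c' (\<lambda>c2 c3.
    sw2 (cm H) g (\<lambda>g1 g2. \<beta> (mul A (mul A a (rt h1 c1)) (f (lt h2 c2) g1)) (m (lt h3 c3) g2))))))"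
proof -
  have "up \<beta> a h c g = sw2 (cm H) h (\<lambda>h1 h'. sw2 (cm A) c (\<lambda>c1 c'. sw2 (cm H) h' (\<lambda>h2 h3. sw2 (cm A) c' (\<lambda>c2 c3.
    sw2 (cm H) g (\<lambda>g1 g2. \<beta> (mul A (mul A a (rt h1 c1)) (f (lt h2 c2) g1)) (m (lt h3 c3) g2))))))"
    unfolding up_def fm_def swp_def mul_assoc
    by (subst cmap2_comult[OF cmap_lt, where t = t, unfolded swp_def])
      (rule bilinI lin_bilin[OF form_bilin] lins refl)+
  then show ?thesis by (subst sw2_swap[of "cm H" _ "cm A"])
qed

end

text \<open>The bridge from representatives to forms: later computations with products of pure
  tensors take place in \<open>up\<close>.\<close>

lemma ev2_upp:
  assumes \<beta>: "bilin (sc A) (sc H) (*) \<beta>"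
  shows "ev2 \<beta> (upp A (H\<lparr>mul := m\<rparr>) lt rt f a h c g) = up \<beta> a h c g"
  unfolding up_eq_sw2[OF lin_bilin2[OF \<beta> lin_id(2)] lin_bilin1[OF \<beta> lin_id(1)]]
  by (simp add: upp_def sw3_def ev2_sw2)

lemma ev2_upm:
  assumes \<beta>: "bilin (sc A) (sc H) (*) \<beta>"
  shows "ev2 \<beta> (upm A (H\<lparr>mul := m\<rparr>) lt rt f M N) = ev2 (\<lambda>a h. ev2 (\<lambda>c g. up \<beta> a h c g) N) M"
  by (simp add: upm_conv_ev2 ev2_ev2 ev2_upp[OF \<beta>])

lemma bilin_up:
  assumes \<beta>: "bilin (sc A) (sc H) t \<beta>"
  shows "bilin (sc A) (sc H) t (\<lambda>a h. up \<beta> a h c g)" "bilin (sc A) (sc H) t (\<lambda>c g. up \<beta> a h c g)"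
  by (intro bilinI lin_up lin_bilin[OF \<beta>] lins)+

text \<open>The associativity axiom evaluated on three pure tensors. Multiplying a product by a
  further factor becomes substituting one form into another.\<close>

lemma up_assoc:
  assumes \<beta>: "bilin (sc A) (sc H) (*) \<beta>"
  shows "up (\<lambda>p q. up \<beta> p q c g) a h b l = up (\<lambda>p q. up \<beta> a h p q) b l c g"
proof -
  let ?mul = "upm A (H\<lparr>mul := m\<rparr>) lt rt f"
  have "teq2 (sc A) (sc H) (?mul (?mul {#(a, h)#} {#(b, l)#}) {#(c, g)#}) (?mul {#(a, h)#} (?mul {#(b, l)#} {#(c, g)#}))"
    using hopf_ext by (simp add: hopf_ext_def unified_hopf_def)
  from this[unfolded teq2_def, rule_format, OF \<beta>]
  show ?thesis
    by (simp add: ev2_upm[OF \<beta>] ev2_upm[OF bilin_up(1)[OF \<beta>]] ev2_upm[OF bilin_up(2)[OF \<beta>]])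
qed

section \<open>The multiplication of \<open>H\<close> as a coalgebra map\<close>

lemma fm_counit:
  assumes \<phi>: "lin (sc H) (*) \<phi>"
  shows "fm (\<lambda>p q. cu A p * \<phi> q) h g = \<phi> (m h g)"
proof -
  have "bilin (sc H) (sc H) (*) (\<lambda>h g. \<phi> (m h g))"
    by (intro bilinI lin_comp[OF \<phi>] lins)
  from swp_counit_left[OF coalg_H coalg_H this] show ?thesis
    by (simp add: fm_def counit_f)
qed

lemma ev4_upp_upp:
  assumes \<chi>: "quadlin (sc A) (sc H) (sc A) (sc H) (*) \<chi>"
  shows "ev4 \<chi> (pair4 (upp A (H\<lparr>mul := m\<rparr>) lt rt f a h c g) (upp A (H\<lparr>mul := m\<rparr>) lt rt f a' h' c' g'))
    = up (\<lambda>p q. up (\<lambda>r s. \<chi> p q r s) a' h' c' g') a h c g"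
proof -
  have 1: "bilin (sc A) (sc H) (*) (\<lambda>r s. \<chi> p q r s)" for p q
    using \<chi> by (auto simp: quadlin_def bilin_def)
  have "bilin (sc A) (sc H) (*) (\<lambda>p q. up (\<lambda>r s. \<chi> p q r s) a' h' c' g')"
    using \<chi> by (auto simp: quadlin_def bilin_def intro!: lins)
  then show ?thesis by (simp add: ev4_pair4 ev2_upp 1)
qed

text \<open>In the unified product, counit and comultiplication are multiplicative. For
  \<open>(1 \<ltimes> h) \<bullet> (1 \<ltimes> g)\<close>, applying the counit of \<open>A\<close>
  to every \<open>A\<close>-component removes \<open>f\<close>, which preserves counits, and leaves
  the corresponding statements about \<open>m\<close>.\<close>

lemma cmap_m: "cmap2 H H H m"
proof (rule cmap2I[OF bilin_m])
  let ?mul = "upm A (H\<lparr>mul := m\<rparr>) lt rt f"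
  fix h g
  have "cuR A (H\<lparr>mul := m\<rparr>) (?mul {#(one A, h)#} {#(one A, g)#}) = cu H h * cu H g"
    using hopf_ext by (simp add: hopf_ext_def unified_hopf_def) (simp add: cuR_conv_ev2)
  moreover have \<epsilon>: "bilin (sc A) (sc H) (*) (\<lambda>a h. cu A a * cu H h)"
    by (intro bilinI lins)
  ultimately show "cu H (m h g) = cu H h * cu H g"
    using up_one_one[of "(*)" "\<lambda>a h. cu A a * cu H h", OF lin_bilin2[OF \<epsilon> lin_id(2)] lin_bilin1[OF \<epsilon> lin_id(1)]]
    by (simp add: cuR_conv_ev2 ev2_upm[OF \<epsilon>] fm_counit lins)
  fix \<beta> :: "'h \<Rightarrow> 'h \<Rightarrow> 'k" assume \<beta>: "bilin (sc H) (sc H) (*) \<beta>"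
  note [lins] = lin_bilin[OF \<beta>]
  \<comment> \<open>This form applies the counit of \<open>A\<close> to both
    \<open>A\<close>-components and \<open>\<beta>\<close> to the two
    \<open>H\<close>-components.\<close>
  define \<chi> where "\<chi> = (\<lambda>a p b q. cu A a * (cu A b * \<beta> p q))"
  have \<chi>: "quadlin (sc A) (sc H) (sc A) (sc H) (*) \<chi>"
    unfolding \<chi>_def by (intro quadlinI lins)
  note lin_\<chi> = lin_quadlin[OF \<chi>]
  have "teq4 (sc A) (sc H) (sc A) (sc H) (cmR A (H\<lparr>mul := m\<rparr>) (?mul {#(one A, h)#} {#(one A, g)#}))
      (up4 A (H\<lparr>mul := m\<rparr>) lt rt f (cmR A (H\<lparr>mul := m\<rparr>) {#(one A, h)#}) (cmR A (H\<lparr>mul := m\<rparr>) {#(one A, g)#}))"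
    using hopf_ext by (simp add: hopf_ext_def unified_hopf_def)
  from this[unfolded teq4_def, rule_format, OF \<chi>]
  have eq: "ev4 \<chi> (cmR A (H\<lparr>mul := m\<rparr>) (?mul {#(one A, h)#} {#(one A, g)#}))
    = ev4 \<chi> (up4 A (H\<lparr>mul := m\<rparr>) lt rt f (cmR A (H\<lparr>mul := m\<rparr>) {#(one A, h)#}) (cmR A (H\<lparr>mul := m\<rparr>) {#(one A, g)#}))" .
  have \<beta>': "bilin (sc A) (sc H) (*) (\<lambda>a h. cu A a * sw2 (cm H) h \<beta>)"
    by (intro bilinI lins lin_comult[OF coalg_H])
  have "ev4 \<chi> (cmT A (H\<lparr>mul := m\<rparr>) a h) = cu A a * sw2 (cm H) h \<beta>" for a h
  proof -
    have "ev4 \<chi> (cmT A (H\<lparr>mul := m\<rparr>) a h) = sw2 (cm A) a (\<lambda>a1 a2. cu A a1 * (cu A a2 * sw2 (cm H) h \<beta>))"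
      by (simp add: ev4_cmT \<chi>_def mult_sw2_left)
    also have "\<dots> = cu A a * sw2 (cm H) h \<beta>"
      by (rule sw2_counit_left[OF coalg_A]) (intro lins)
    finally show ?thesis .
  qed
  then have "ev4 \<chi> (cmR A (H\<lparr>mul := m\<rparr>) (?mul {#(one A, h)#} {#(one A, g)#}))
      = up (\<lambda>a h. cu A a * sw2 (cm H) h \<beta>) (one A) h (one A) g"
    by (simp add: cmR_conv_ev2 ev4_ev2 ev2_upm[OF \<beta>'])
  also have "\<dots> = sw2 (cm H) (m h g) \<beta>"
    using fm_counit[OF lin_comult[OF coalg_H lin_id(2) lin_bilin2[OF \<beta> lin_id(2)] lin_bilin1[OF \<beta> lin_id(2)]]]
    by (subst up_one_one[where t = "(*)"]) (intro lins lin_comult[OF coalg_H] | simp)+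
  finally have L: "ev4 \<chi> (cmR A (H\<lparr>mul := m\<rparr>) (?mul {#(one A, h)#} {#(one A, g)#})) = sw2 (cm H) (m h g) \<beta>" .
  have "ev4 \<chi> (up4 A (H\<lparr>mul := m\<rparr>) lt rt f (cmR A (H\<lparr>mul := m\<rparr>) {#(one A, h)#}) (cmR A (H\<lparr>mul := m\<rparr>) {#(one A, g)#}))
    = sw2 (cm A) (one A) (\<lambda>a a'. sw2 (cm H) h (\<lambda>h1 h2. sw2 (cm A) (one A) (\<lambda>c c'. sw2 (cm H) g (\<lambda>g1 g2.
        up (\<lambda>p q. up (\<lambda>r s. \<chi> p q r s) a' h2 c' g2) a h1 c g1))))"
    by (simp add: up4_conv_ev4 cmR_conv_ev2 ev4_ev4 ev4_cmT ev4_sw2 ev4_upp_upp[OF \<chi>])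
  also have "\<dots> = sw2 (cm H) h (\<lambda>h1 h2. sw2 (cm A) (one A) (\<lambda>c c'. sw2 (cm H) g (\<lambda>g1 g2.
        up (\<lambda>p q. up (\<lambda>r s. \<chi> p q r s) (one A) h2 c' g2) (one A) h1 c g1)))"
    by (rule comult_one[where t = "(*)"]) (intro lins lin_up lin_\<chi>)+
  also have "\<dots> = sw2 (cm H) h (\<lambda>h1 h2. sw2 (cm H) g (\<lambda>g1 g2.
        up (\<lambda>p q. up (\<lambda>r s. \<chi> p q r s) (one A) h2 (one A) g2) (one A) h1 (one A) g1))"
    by (subst comult_one[where t = "(*)"]) (intro lins lin_up lin_\<chi> refl)+
  also have "\<dots> = swp H H h g (\<lambda>h1 g1 h2 g2. fm (\<lambda>p q. fm (\<lambda>r s. \<chi> p q r s) h2 g2) h1 g1)"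
    by (subst up_one_one[where t = "(*)"], (intro lins lin_up lin_\<chi>)+)+ (simp add: swp_def)
  also have "\<dots> = swp H H h g (\<lambda>h1 g1 h2 g2. \<beta> (m h1 g1) (m h2 g2))"
  proof -
    have "fm (\<lambda>r s. \<chi> p q r s) h2 g2 = cu A p * \<beta> q (m h2 g2)" for p q h2 g2
    proof -
      have "fm (\<lambda>r s. cu A r * (cu A p * \<beta> q s)) h2 g2 = cu A p * \<beta> q (m h2 g2)"
        by (rule fm_counit) (intro lins)
      then show ?thesis by (simp add: \<chi>_def mult.left_commute)
    qed
    then show ?thesis by (simp add: fm_counit[OF lin_bilin1[OF \<beta> lin_id(2)]])
  qed
  finally show "sw2 (cm H) (m h g) \<beta> = swp H H h g (\<lambda>h1 g1 h2 g2. \<beta> (m h1 g1) (m h2 g2))"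
    using eq L by simp
qed

text \<open>Left \<open>A\<close>-linearity of the product, with the scalar moved into the form. It
  reduces computations to a left factor \<open>1 \<ltimes> h\<close>.\<close>

lemma up_mul: "up \<beta> (mul A a b) = up (\<lambda>p q. \<beta> (mul A a p) q) b"
  by (intro ext) (simp add: up_def mul_assoc)

end

section \<open>Comparing two unified products along a lazy cocycle\<close>

locale cocycle_pair = ext_hopf A SA H m lt rt f + e': ext_hopf A SA H m' lt' rt' f'
  for A :: "('k::field, 'a::ab_group_add) kstr" and SA
    and H :: "('k, 'h::ab_group_add) kstr" and m lt rt f m' lt' rt' f' +
  fixes u :: "'h \<Rightarrow> 'a"
  assumes u: "lazy_cocycle A H u"
begin

lemma lin_u: "lin (sc H) (sc A) u"
  and counit_u: "cu A (u h) = cu H h"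
  and u_one [simp]: "u (one H) = one A"
  using u by (simp_all add: lazy_cocycle_def)

lemmas lin_u' [lins] = lin_comp[OF lin_u]

section \<open>Sweedler rules for the lazy cocycle\<close>

lemma comult_u:
  assumes "\<And>x. lin (sc A) t (\<lambda>y. B x y)" "\<And>y. lin (sc A) t (\<lambda>x. B x y)"
  shows "sw2 (cm A) (u h) (\<lambda>x y. B x y) = sw2 (cm H) h (\<lambda>x y. B (u x) (u y))"
proof -
  have "teq2 (sc A) (sc A) (cm A (u h)) (sw2 (cm H) h (\<lambda>x y. {#(u x, u y)#}))"
    using u by (simp add: lazy_cocycle_def)
  from teq2D[OF this, of t B] assms show ?thesis
    by (simp add: ev2_sw2 sw2_def[of "cm A"])
qed

lemma u_lazy:
  assumes "\<And>x. lin (sc A) t (\<lambda>y. B x y)" "\<And>y. lin (sc H) t (\<lambda>x. B x y)"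
  shows "sw2 (cm H) h (\<lambda>x y. B x (u y)) = sw2 (cm H) h (\<lambda>x y. B y (u x))"
proof -
  have "teq2 (sc H) (sc A) (sw2 (cm H) h (\<lambda>x y. {#(x, u y)#})) (sw2 (cm H) h (\<lambda>x y. {#(y, u x)#}))"
    using u by (simp add: lazy_cocycle_def)
  from teq2D[OF this, of t B] assms show ?thesis
    by (simp add: ev2_sw2)
qed

text \<open>Coassociativity makes the two middle positions the halves of a single element, and
  laziness exchanges them: \<open>g\<^sub>1 \<otimes> u(g\<^sub>2) \<otimes> g\<^sub>3 \<otimes>
  g\<^sub>4 = g\<^sub>1 \<otimes> u(g\<^sub>3) \<otimes> g\<^sub>2 \<otimes>
  g\<^sub>4\<close>.\<close>

lemma u_lazy_middle:
  assumes T: "\<And>a x y. lin (sc H) t (\<lambda>c. T c a x y)" "\<And>c x y. lin (sc A) t (\<lambda>a. T c a x y)"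
    "\<And>c a y. lin (sc H) t (\<lambda>x. T c a x y)" "\<And>c a x. lin (sc H) t (\<lambda>y. T c a x y)"
  shows "sw2 (cm H) g (\<lambda>g1 g2. sw2 (cm H) g1 (\<lambda>c d. sw2 (cm H) g2 (\<lambda>p q. T c (u d) p q)))
    = sw2 (cm H) g (\<lambda>g1 g2. sw2 (cm H) g1 (\<lambda>c p. sw2 (cm H) g2 (\<lambda>d q. T c (u d) p q)))"
proof -
  have T': "lin s (sc H) F \<Longrightarrow> lin s t (\<lambda>c. T (F c) a x y)" "lin s' (sc A) G \<Longrightarrow> lin s' t (\<lambda>a. T c (G a) x y)"
    "lin s (sc H) F \<Longrightarrow> lin s t (\<lambda>x. T c a (F x) y)" "lin s (sc H) F \<Longrightarrow> lin s t (\<lambda>y. T c a x (F y))"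
    for s s' a c x y and F :: "'x::ab_group_add \<Rightarrow> 'h" and G :: "'y::ab_group_add \<Rightarrow> 'a"
    by (rule lin_comp[OF T(1)] lin_comp[OF T(2)] lin_comp[OF T(3)] lin_comp[OF T(4)]; assumption)+
  have inner: "sw2 (cm H) w (\<lambda>d g2. sw2 (cm H) g2 (\<lambda>p q. T c (u d) p q))
      = sw2 (cm H) w (\<lambda>p g2. sw2 (cm H) g2 (\<lambda>d q. T c (u d) p q))" for c w
  proof -
    have "sw2 (cm H) w (\<lambda>d g2. sw2 (cm H) g2 (\<lambda>p q. T c (u d) p q))
      = sw2 (cm H) w (\<lambda>z q. sw2 (cm H) z (\<lambda>d p. T c (u d) p q))"
      by (rule sw2_coassoc[OF coalg_H, where t = t, symmetric]) (intro lins T')+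
    also have "\<dots> = sw2 (cm H) w (\<lambda>z q. sw2 (cm H) z (\<lambda>p d. T c (u d) p q))"
      by (subst u_lazy[where t = t and B = "\<lambda>p d. T _ d p _", symmetric]) (intro lins T' refl)+
    also have "\<dots> = sw2 (cm H) w (\<lambda>p g2. sw2 (cm H) g2 (\<lambda>d q. T c (u d) p q))"
      by (rule sw2_coassoc[OF coalg_H, where t = t]) (intro lins T')+
    finally show ?thesis .
  qed
  have "sw2 (cm H) g (\<lambda>g1 g2. sw2 (cm H) g1 (\<lambda>c d. sw2 (cm H) g2 (\<lambda>p q. T c (u d) p q)))
    = sw2 (cm H) g (\<lambda>c w. sw2 (cm H) w (\<lambda>d g2. sw2 (cm H) g2 (\<lambda>p q. T c (u d) p q)))"
    by (rule sw2_coassoc[OF coalg_H, where t = t]) (intro lin_comult[OF coalg_H] lins T')+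
  also have "\<dots> = sw2 (cm H) g (\<lambda>c w. sw2 (cm H) w (\<lambda>p g2. sw2 (cm H) g2 (\<lambda>d q. T c (u d) p q)))"
    by (simp only: inner)
  also have "\<dots> = sw2 (cm H) g (\<lambda>g1 g2. sw2 (cm H) g1 (\<lambda>c p. sw2 (cm H) g2 (\<lambda>d q. T c (u d) p q)))"
    by (rule sw2_coassoc[OF coalg_H, where t = t, symmetric]) (intro lin_comult[OF coalg_H] lins T')+
  finally show ?thesis .
qed

text \<open>\<open>ph \<beta> a h\<close> is the value of \<open>\<beta>\<close> on \<open>a u(h\<^sub>1) \<ltimes> h\<^sub>2\<close>.\<close>
definition ph :: "('a \<Rightarrow> 'h \<Rightarrow> 'c::ab_group_add) \<Rightarrow> 'a \<Rightarrow> 'h \<Rightarrow> 'c" where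
  "ph \<beta> a h = sw2 (cm H) h (\<lambda>h1 h2. \<beta> (mul A a (u h1)) h2)"

lemma ev2_phi: "ev2 \<beta> (phi_of A H u a h) = ph \<beta> a h"
  by (simp add: phi_of_def ph_def ev2_sw2)

lemma lin_ph_body [lins]: "(\<And>p q. lin s t (\<lambda>x. T x p q)) \<Longrightarrow> lin s t (\<lambda>x. ph (\<lambda>p q. T x p q) a h)"
  unfolding ph_def by (intro lins)

lemma bilin_ph:
  assumes \<beta>: "bilin (sc A) (sc H) t \<beta>"
  shows "bilin (sc A) (sc H) t (ph \<beta>)"
  unfolding ph_def by (intro bilinI lin_comult[OF coalg_H] lins lin_bilin[OF \<beta>])

lemma ph_one:
  assumes \<beta>: "bilin (sc A) (sc H) t \<beta>"
  shows "ph \<beta> a (one H) = \<beta> a (one H)"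
  unfolding ph_def by (subst comult_one_H[where t = t]) (intro lin_bilin[OF \<beta>] lins | simp)+

text \<open>\<open>ph\<close> comultiplies \<open>Q(x\<^sub>2)\<close>. As \<open>Q\<close> is a
  coalgebra map, the result is \<open>X(x\<^sub>1) u(Q(x\<^sub>2)) \<otimes> Q(x\<^sub>3)\<close>,
  whose first factor is a convolution product.\<close>

lemma ph_tensor:
  assumes V: "coalg V" and W: "coalg W" and X: "bilin (sc V) (sc W) (sc A) X" and Q: "cmap2 V W H Q"
    and \<beta>: "bilin (sc A) (sc H) t \<beta>"
  shows "swp V W v w (\<lambda>v1 w1 v2 w2. ph \<beta> (X v1 w1) (Q v2 w2))
    = swp V W v w (\<lambda>v1 w1 v2 w2. \<beta> (pconv V W X (\<lambda>v w. u (Q v w)) v1 w1) (Q v2 w2))"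
proof -
  note Q' = cmap2_bilin[OF Q]
  have uQ: "bilin (sc V) (sc W) (sc A) (\<lambda>v w. u (Q v w))"
    by (intro bilinI lins lin_bilin[OF Q'] lin_ident coalg_vs V W)
  show ?thesis
    unfolding pconv_tensor[OF V W X uQ Q' \<beta>] ph_def
    by (subst cmap2_comult[OF Q, where t = t]) (intro bilinI lin_bilin[OF \<beta>] lins refl)+
qed

text \<open>Left convolution with the map \<open>u(v) \<epsilon>(w)\<close>, where the counit in
  \<open>w\<close> has already been absorbed.\<close>

definition lconv :: "('h \<Rightarrow> 'w \<Rightarrow> 'a) \<Rightarrow> 'h \<Rightarrow> 'w \<Rightarrow> 'a" where
  "lconv G v w = sw2 (cm H) v (\<lambda>v1 v2. mul A (u v1) (G v2 w))"

lemma bilin_lconv: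
  assumes G: "bilin (sc H) (sc W) (sc A) G"
  shows "bilin (sc H) (sc W) (sc A) (lconv G)"
  unfolding lconv_def
  by (intro bilinI lin_comult[OF coalg_H] lins lin_bilin[OF G] lin_ident bilinD(2)[OF G])

lemma counit_lconv:
  assumes G: "\<And>v w. cu A (G v w) = cu H v * cu W w"
  shows "cu A (lconv G v w) = cu H v * cu W w"
  unfolding lconv_def lin_sw2[OF lin_cuA[OF lin_id(1)]]
  by (simp add: counit_mul counit_u G sw2_counit_left[OF coalg_H lin_mult_right[OF lin_cuH[OF lin_id(2)]]])

lemma lconv_tensor:
  assumes W: "coalg W" and G: "bilin (sc H) (sc W) (sc A) G" and Q: "bilin (sc H) (sc W) s Q"
    and \<beta>: "bilin (sc A) s t \<beta>"
  shows "swp H W v w (\<lambda>v1 w1 v2 w2. \<beta> (lconv G v1 w1) (Q v2 w2))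
    = sw2 (cm H) v (\<lambda>v1 v'. swp H W v' w (\<lambda>v2 w1 v3 w2. \<beta> (mul A (u v1) (G v2 w1)) (Q v3 w2)))"
proof -
  have "swp H W v w (\<lambda>v1 w1 v2 w2. \<beta> (lconv G v1 w1) (Q v2 w2))
    = sw2 (cm H) v (\<lambda>v' v3. sw2 (cm H) v' (\<lambda>v1 v2. sw2 (cm W) w (\<lambda>w1 w2. \<beta> (mul A (u v1) (G v2 w1)) (Q v3 w2))))"
    unfolding swp_def lconv_def lin_sw2[OF lin_bilin1[OF \<beta> lin_id(1)]]
    by (subst sw2_swap[of "cm W" w]) rule
  also have "\<dots> = sw2 (cm H) v (\<lambda>v1 v'. swp H W v' w (\<lambda>v2 w1 v3 w2. \<beta> (mul A (u v1) (G v2 w1)) (Q v3 w2)))"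
    unfolding swp_def
    by (rule sw2_coassoc[OF coalg_H, where t = t]) (intro lins lin_bilin[OF \<beta>] lin_bilin[OF G] lin_bilin[OF Q])+
  finally show ?thesis .
qed

section \<open>Multiplicativity on the two kinds of generating products\<close>

lemma phi_mult_A_iff:
  "(\<forall>\<beta> h c. bilin (sc A) (sc H) (*) \<beta> \<longrightarrow>
      e'.up (ph \<beta>) (one A) h c (one H) = sw2 (cm H) h (\<lambda>h1 h2. up \<beta> (u h1) h2 c (one H)))
    \<longleftrightarrow> pconv H A rt' (\<lambda>h c. u (lt' h c)) = lconv rt \<and> lt' = lt"
proof -
  have brt: "bilin (sc H) (sc A) (sc A) rt" and brt': "bilin (sc H) (sc A) (sc A) rt'"
    and blt: "bilin (sc H) (sc A) (sc H) lt" and blt': "bilin (sc H) (sc A) (sc H) lt'"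
    and bult': "bilin (sc H) (sc A) (sc A) (\<lambda>h c. u (lt' h c))"
    by (intro bilinI lins lin_lt lin_rt e'.lin_lt e'.lin_rt)+
  \<comment> \<open>Both sides are brought to the form
    \<open>P(x\<^sub>1) \<otimes> Q(x\<^sub>2)\<close> over \<open>H \<otimes> A\<close>, so that
    \<open>tensor_cancel\<close> can compare the factors.\<close>
  have "e'.up (ph \<beta>) (one A) h c (one H) = swp H A h c (\<lambda>h1 c1 h2 c2. \<beta> (pconv H A rt' (\<lambda>h c. u (lt' h c)) h1 c1) (lt' h2 c2))"
    "sw2 (cm H) h (\<lambda>h1 h2. up \<beta> (u h1) h2 c (one H)) = swp H A h c (\<lambda>h1 c1 h2 c2. \<beta> (lconv rt h1 c1) (lt h2 c2))"
    if \<beta>: "bilin (sc A) (sc H) (*) \<beta>" for \<beta> h c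
  proof -
    note ph = bilin_ph[OF \<beta>]
    show "e'.up (ph \<beta>) (one A) h c (one H) = swp H A h c (\<lambda>h1 c1 h2 c2. \<beta> (pconv H A rt' (\<lambda>h c. u (lt' h c)) h1 c1) (lt' h2 c2))"
      by (simp add: e'.up_one_right[OF lin_bilin2[OF ph lin_id(2)] lin_bilin1[OF ph lin_id(1)]]
          ph_tensor[OF coalg_H coalg_A brt' e'.cmap_lt \<beta>])
    show "sw2 (cm H) h (\<lambda>h1 h2. up \<beta> (u h1) h2 c (one H)) = swp H A h c (\<lambda>h1 c1 h2 c2. \<beta> (lconv rt h1 c1) (lt h2 c2))"
      by (simp add: up_one_right[OF lin_bilin2[OF \<beta> lin_id(2)] lin_bilin1[OF \<beta> lin_id(1)]]
          lconv_tensor[OF coalg_A brt blt \<beta>])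
  qed
  note eq = this
  have "cu A (pconv H A rt' (\<lambda>h c. u (lt' h c)) h c) = cu H h * cu A c" for h c
    by (rule counit_pconv[OF coalg_H coalg_A brt' _ bult']) (simp_all add: e'.counit_rt counit_u e'.counit_lt)
  moreover have "cu A (lconv rt h c) = cu H h * cu A c" for h c
    by (rule counit_lconv[OF counit_rt])
  ultimately show ?thesis
    using tensor_cancel[OF coalg_H coalg_A coalg_H bilin_pconv[OF coalg_H coalg_A brt' bult'] _
        bilin_lconv[OF brt] _ blt' e'.counit_lt blt counit_lt]
    by (simp add: eq cong: imp_cong)
qed

text \<open>\<open>M\<close> is the multiplication that (iii) prescribes for the second structure.
  \<open>R\<close>, \<open>F\<close> and \<open>M\<close> are the factors into which the sum of
  \<open>(1 \<ltimes> h) \<bullet> (u(g\<^sub>1) \<ltimes> g\<^sub>2)\<close> splits.\<close>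

definition R :: "'h \<Rightarrow> 'h \<Rightarrow> 'a" where "R h g = rt h (u g)"
definition F :: "'h \<Rightarrow> 'h \<Rightarrow> 'a" where "F h g = sw2 (cm H) g (\<lambda>g1 g2. f (lt h (u g1)) g2)"
definition M :: "'h \<Rightarrow> 'h \<Rightarrow> 'h" where "M h g = sw2 (cm H) g (\<lambda>g1 g2. m (lt h (u g1)) g2)"

lemma bilin_R: "bilin (sc H) (sc H) (sc A) R" and bilin_F: "bilin (sc H) (sc H) (sc A) F"
  and bilin_M: "bilin (sc H) (sc H) (sc H) M"
  unfolding R_def F_def M_def by (intro bilinI lins lin_comult[OF coalg_H])+

lemma counit_R: "cu A (R h g) = cu H h * cu H g" and counit_F: "cu A (F h g) = cu H h * cu H g"
  and counit_M: "cu H (M h g) = cu H h * cu H g"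
  unfolding F_def M_def R_def lin_sw2[OF lin_cuA[OF lin_id(1)]] lin_sw2[OF lin_cuH[OF lin_id(2)]]
  using sw2_counit_left[OF coalg_H lin_mult_left[OF lin_cuH[OF lin_id(2)]], of g "cu H h"]
  by (simp_all add: counit_rt counit_u counit_f counit_lt cmap2_counit[OF cmap_m] ac_simps)

text \<open>As \<open>lt\<close> and \<open>u\<close> are coalgebra maps, the left side is
  \<open>f(h\<^sub>1 \<triangleleft> u(g\<^sub>1), g\<^sub>3) \<otimes> (h\<^sub>2 \<triangleleft>
  u(g\<^sub>2)) \<cdot> g\<^sub>4\<close>. Laziness exchanges positions 2 and 3 of \<open>g\<close>,
  after which the two tensor factors use consecutive parts of \<open>g\<close>.\<close>

lemma fm_lt_u:
  assumes \<delta>: "bilin (sc A) (sc H) t \<delta>"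
  shows "sw2 (cm H) g (\<lambda>g1 g2. fm \<delta> (lt h (u g1)) g2) = swp H H h g (\<lambda>h1 g1 h2 g2. \<delta> (F h1 g1) (M h2 g2))"
proof -
  have "sw2 (cm H) g (\<lambda>g1 g2. fm \<delta> (lt h (u g1)) g2)
    = sw2 (cm H) g (\<lambda>g1 g2. sw2 (cm H) h (\<lambda>h1 h2. sw2 (cm A) (u g1) (\<lambda>a1 a2. sw2 (cm H) g2 (\<lambda>p q. \<delta> (f (lt h1 a1) p) (m (lt h2 a2) q)))))"
    unfolding fm_def swp_def
    by (subst cmap2_comult[OF cmap_lt, where t = t, unfolded swp_def])
      (intro bilinI lin_bilin[OF \<delta>] lins refl)+
  also have "\<dots> = sw2 (cm H) g (\<lambda>g1 g2. sw2 (cm H) h (\<lambda>h1 h2. sw2 (cm H) g1 (\<lambda>c d. sw2 (cm H) g2 (\<lambda>p q. \<delta> (f (lt h1 (u c)) p) (m (lt h2 (u d)) q)))))"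
    by (subst comult_u[where t = t]) (intro lin_bilin[OF \<delta>] lins refl)+
  also have "\<dots> = sw2 (cm H) h (\<lambda>h1 h2. sw2 (cm H) g (\<lambda>g1 g2. sw2 (cm H) g1 (\<lambda>c d. sw2 (cm H) g2 (\<lambda>p q. \<delta> (f (lt h1 (u c)) p) (m (lt h2 (u d)) q)))))"
    by (rule sw2_swap)
  also have "\<dots> = sw2 (cm H) h (\<lambda>h1 h2. sw2 (cm H) g (\<lambda>g1 g2. sw2 (cm H) g1 (\<lambda>c p. sw2 (cm H) g2 (\<lambda>d q. \<delta> (f (lt h1 (u c)) p) (m (lt h2 (u d)) q)))))"
    by (subst u_lazy_middle[where t = t]) (intro lin_bilin[OF \<delta>] lins refl)+
  also have "\<dots> = swp H H h g (\<lambda>h1 g1 h2 g2. \<delta> (F h1 g1) (M h2 g2))"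
    unfolding swp_def F_def M_def lin_sw2[OF lin_bilin1[OF \<delta> lin_id(1)]]
    unfolding lin_sw2[OF lin_bilin2[OF \<delta> lin_id(2)]] ..
  finally show ?thesis .
qed

text \<open>The product is computed first with \<open>1 \<ltimes> h\<close> on the left, where
  \<open>fm_lt_u\<close> separates the factors. Left \<open>A\<close>-linearity then restores
  \<open>u(h\<^sub>1)\<close>, which becomes a left convolution.\<close>

lemma up_phi:
  assumes \<beta>: "bilin (sc A) (sc H) t \<beta>"
  shows "sw2 (cm H) h (\<lambda>h1 h2. sw2 (cm H) g (\<lambda>g1 g2. up \<beta> (u h1) h2 (u g1) g2))
    = swp H H h g (\<lambda>h1 g1 h2 g2. \<beta> (lconv (pconv H H R F) h1 g1) (M h2 g2))"
proof -
  have *: "sw2 (cm H) g (\<lambda>g1 g2. up \<gamma> (one A) h (u g1) g2)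
    = swp H H h g (\<lambda>h1 g1 h2 g2. \<gamma> (pconv H H R F h1 g1) (M h2 g2))" if \<gamma>: "bilin (sc A) (sc H) t \<gamma>" for \<gamma> h
  proof -
    have "sw2 (cm H) g (\<lambda>g1 g2. up \<gamma> (one A) h (u g1) g2)
      = sw2 (cm H) g (\<lambda>g1 g2. sw2 (cm H) h (\<lambda>h1 h2. sw2 (cm H) g1 (\<lambda>c d. fm (\<lambda>p q. \<gamma> (mul A (rt h1 (u c)) p) q) (lt h2 (u d)) g2)))"
      unfolding up_def swp_def mul_one
      by (subst comult_u[where t = t]) (intro lin_bilin[OF \<gamma>] lin_fm lins refl)+
    also have "\<dots> = sw2 (cm H) h (\<lambda>h1 h2. sw2 (cm H) g (\<lambda>g1 g2. sw2 (cm H) g1 (\<lambda>c d. fm (\<lambda>p q. \<gamma> (mul A (rt h1 (u c)) p) q) (lt h2 (u d)) g2)))"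
      by (rule sw2_swap)
    also have "\<dots> = sw2 (cm H) h (\<lambda>h1 h2. sw2 (cm H) g (\<lambda>c w. sw2 (cm H) w (\<lambda>d g2. fm (\<lambda>p q. \<gamma> (mul A (rt h1 (u c)) p) q) (lt h2 (u d)) g2)))"
      by (subst sw2_coassoc[OF coalg_H, where t = t]) (intro lin_bilin[OF \<gamma>] lin_fm lins refl)+
    also have "\<dots> = swp H H h g (\<lambda>h1 g1 h2 g2. swp H H h2 g2 (\<lambda>h2 g2 h3 g3. \<gamma> (mul A (R h1 g1) (F h2 g2)) (M h3 g3)))"
      unfolding swp_def[of H H h g] R_def
      by (subst fm_lt_u[where t = t]) (intro bilinI lin_bilin[OF \<gamma>] lins refl)+
    also have "\<dots> = swp H H h g (\<lambda>h1 g1 h2 g2. \<gamma> (pconv H H R F h1 g1) (M h2 g2))"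
      by (rule pconv_tensor[OF coalg_H coalg_H bilin_R bilin_F bilin_M \<gamma>, symmetric])
    finally show ?thesis .
  qed
  have "bilin (sc A) (sc H) t (\<lambda>p q. \<beta> (mul A a p) q)" for a
    by (intro bilinI lin_bilin[OF \<beta>] lins)
  from *[OF this] show ?thesis
    using up_mul[of \<beta> _ "one A"]
    by (simp add: lconv_tensor[OF coalg_H bilin_pconv[OF coalg_H coalg_H bilin_R bilin_F] bilin_M \<beta>])
qed

text \<open>Both sides factor over \<open>H \<otimes> H\<close>: the left by
  \<open>ph_tensor\<close>, which needs that \<open>m'\<close> is a coalgebra map, the right by
  \<open>up_phi\<close>. Then \<open>tensor_cancel\<close> applies.\<close>

lemma phi_mult_H_iff:
  "(\<forall>\<beta> h g. bilin (sc A) (sc H) (*) \<beta> \<longrightarrow>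
      e'.up (ph \<beta>) (one A) h (one A) g = sw2 (cm H) h (\<lambda>h1 h2. sw2 (cm H) g (\<lambda>g1 g2. up \<beta> (u h1) h2 (u g1) g2)))
    \<longleftrightarrow> pconv H H f' (\<lambda>h g. u (m' h g)) = lconv (pconv H H R F) \<and> m' = M"
proof -
  have bf': "bilin (sc H) (sc H) (sc A) f'" and bum': "bilin (sc H) (sc H) (sc A) (\<lambda>h g. u (m' h g))"
    by (intro bilinI lins e'.lin_f e'.lin_m)+
  have "e'.up (ph \<beta>) (one A) h (one A) g = swp H H h g (\<lambda>h1 g1 h2 g2. \<beta> (pconv H H f' (\<lambda>h g. u (m' h g)) h1 g1) (m' h2 g2))"
    if \<beta>: "bilin (sc A) (sc H) (*) \<beta>" for \<beta> h g
  proof -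
    note ph = bilin_ph[OF \<beta>]
    show ?thesis
      by (simp add: e'.up_one_one[OF lin_bilin2[OF ph lin_id(2)] lin_bilin1[OF ph lin_id(1)]] e'.fm_def
          ph_tensor[OF coalg_H coalg_H bf' e'.cmap_m \<beta>])
  qed
  note eq = this up_phi[where t = "(*)"]
  note brf = bilin_pconv[OF coalg_H coalg_H bilin_R bilin_F]
  have "cu A (pconv H H f' (\<lambda>h g. u (m' h g)) h g) = cu H h * cu H g" for h g
    by (rule counit_pconv[OF coalg_H coalg_H bf' _ bum']) (simp_all add: e'.counit_f counit_u cmap2_counit[OF e'.cmap_m])
  moreover have "cu A (lconv (pconv H H R F) h g) = cu H h * cu H g" for h g
    by (rule counit_lconv[OF counit_pconv[OF coalg_H coalg_H bilin_R counit_R bilin_F counit_F]])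
  ultimately show ?thesis
    using tensor_cancel[OF coalg_H coalg_H coalg_H bilin_pconv[OF coalg_H coalg_H bf' bum'] _
        bilin_lconv[OF brf] _ e'.bilin_m cmap2_counit[OF e'.cmap_m] bilin_M counit_M]
    by (simp add: eq cong: imp_cong)
qed

section \<open>Conditions (i) to (iii) as convolution identities\<close>

lemma cmap_u:
  assumes Q: "cmap2 V W H Q"
  shows "cmap2 V W A (\<lambda>v w. u (Q v w))"
proof (rule cmap2I)
  note Q' = cmap2_bilin[OF Q]
  show "bilin (sc V) (sc W) (sc A) (\<lambda>v w. u (Q v w))"
    by (intro bilinI lins lin_bilin[OF Q'] lin_ident bilinD(1,2)[OF Q'])
  show "cu A (u (Q v w)) = cu V v * cu W w" for v w
    by (simp add: counit_u cmap2_counit[OF Q])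
  fix \<beta> :: "'a \<Rightarrow> 'a \<Rightarrow> 'k" and v w
  assume \<beta>: "bilin (sc A) (sc A) (*) \<beta>"
  have "sw2 (cm A) (u (Q v w)) \<beta> = sw2 (cm H) (Q v w) (\<lambda>x y. \<beta> (u x) (u y))"
    by (rule comult_u[where t = "(*)"]) (intro lin_bilin[OF \<beta>] lins)+
  also have "\<dots> = swp V W v w (\<lambda>v1 w1 v2 w2. \<beta> (u (Q v1 w1)) (u (Q v2 w2)))"
    by (rule cmap2_comult[OF Q, where t = "(*)"]) (intro bilinI lin_bilin[OF \<beta>] lins)
  finally show "sw2 (cm A) (u (Q v w)) \<beta> = swp V W v w (\<lambda>v1 w1 v2 w2. \<beta> (u (Q v1 w1)) (u (Q v2 w2)))" .
qed

text \<open>Convolving with the inverses of \<open>u \<circ> lt'\<close> and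
  \<open>u \<circ> m'\<close> isolates \<open>rt'\<close> and \<open>f'\<close>; expanding the
  convolutions gives the sums in (i) and (ii). The assumption identifies the \<open>lt\<close>
  inside (i) with the \<open>lt'\<close> of the convolution identity.\<close>

lemma conds_iff:
  assumes lt: "lt' = lt"
  shows "conds A SA (H\<lparr>mul := m\<rparr>) lt rt f m' rt' f' u \<longleftrightarrow>
    pconv H A rt' (\<lambda>h c. u (lt' h c)) = lconv rt \<and>
    pconv H H f' (\<lambda>h g. u (m' h g)) = lconv (pconv H H R F) \<and> m' = M"
proof -
  note brf = bilin_pconv[OF coalg_H coalg_H bilin_R bilin_F]
  note brt = cmap2_bilin[OF cmap_rt]
  have bS: "bilin (sc H) (sc A) (sc A) (\<lambda>h c. SA (u (lt h c)))"
    and bS': "bilin (sc H) (sc H) (sc A) (\<lambda>h c. SA (u (m' h c)))"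
    by (intro bilinI lins e'.lin_m)+
  have "pconv H A (lconv rt) (\<lambda>h c. SA (u (lt h c))) h c
      = sw3 (cm H) h (\<lambda>h1 h2 h3. sw2 (cm A) c (\<lambda>c1 c2. mul A (mul A (u h1) (rt h2 c1)) (SA (u (lt h3 c2)))))" for h c
    unfolding pconv_def lconv_tensor[OF coalg_A brt bS bilin_mul] by (simp add: sw3_def swp_def)
  moreover have "pconv H H (lconv (pconv H H R F)) (\<lambda>h g. SA (u (m' h g))) h g
      = sw4 (cm H) h (\<lambda>h1 h2 h3 h4. sw4 (cm H) g (\<lambda>g1 g2 g3 g4.
          mul A (mul A (mul A (u h1) (rt h2 (u g1))) (f (lt h3 (u g2)) g3)) (SA (u (m' h4 g4)))))" for h g
  proof -
    have b: "bilin (sc A) (sc A) (sc A) (\<lambda>a b. mul A (mul A x a) b)" for x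
      by (intro bilinI lins)
    have "pconv H H (lconv (pconv H H R F)) (\<lambda>h g. SA (u (m' h g))) h g
      = sw2 (cm H) h (\<lambda>h1 y. sw2 (cm H) y (\<lambda>h2 z. sw2 (cm H) g (\<lambda>g1 w. sw2 (cm H) z (\<lambda>h3 h4. sw2 (cm H) w (\<lambda>w' g4.
        sw2 (cm H) w' (\<lambda>g2 g3. mul A (mul A (u h1) (mul A (rt h2 (u g1)) (f (lt h3 (u g2)) g3))) (SA (u (m' h4 g4)))))))))"
      unfolding pconv_def[of H H "lconv _"] lconv_tensor[OF coalg_H brf bS' bilin_mul]
        pconv_tensor[OF coalg_H coalg_H bilin_R bilin_F bS' b]
      by (simp add: swp_def R_def F_def mul_sw2_left mul_sw2_right)
    also have "\<dots> = sw2 (cm H) h (\<lambda>h1 y. sw2 (cm H) y (\<lambda>h2 z. sw2 (cm H) z (\<lambda>h3 h4. sw2 (cm H) g (\<lambda>g1 w. sw2 (cm H) w (\<lambda>w' g4.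
        sw2 (cm H) w' (\<lambda>g2 g3. mul A (mul A (u h1) (mul A (rt h2 (u g1)) (f (lt h3 (u g2)) g3))) (SA (u (m' h4 g4)))))))))"
      by (subst sw2_swap[of "cm H" g]) rule
    \<comment> \<open>The factor \<open>F\<close> splits the first half of \<open>w\<close>, while
      \<open>sw4\<close> always splits the last part; coassociativity moves the nesting to the
      right.\<close>
    also have "\<dots> = sw2 (cm H) h (\<lambda>h1 y. sw2 (cm H) y (\<lambda>h2 z. sw2 (cm H) z (\<lambda>h3 h4. sw2 (cm H) g (\<lambda>g1 w. sw2 (cm H) w (\<lambda>g2 w'.
        sw2 (cm H) w' (\<lambda>g3 g4. mul A (mul A (u h1) (mul A (rt h2 (u g1)) (f (lt h3 (u g2)) g3))) (SA (u (m' h4 g4)))))))))"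
      by (subst sw2_coassoc[OF coalg_H, where t = "sc A"]) (intro lins e'.lin_m refl)+
    finally show ?thesis by (simp add: sw4_def sw3_def mul_assoc)
  qed
  ultimately have "conds A SA (H\<lparr>mul := m\<rparr>) lt rt f m' rt' f' u \<longleftrightarrow>
      rt' = pconv H A (lconv rt) (\<lambda>h c. SA (u (lt' h c))) \<and>
      f' = pconv H H (lconv (pconv H H R F)) (\<lambda>h g. SA (u (m' h g))) \<and> m' = M"
    by (simp add: conds_def fun_eq_iff M_def lt)
  then show ?thesis
    by (simp add: pconv_cancel[OF coalg_H coalg_A cmap2_bilin[OF e'.cmap_rt] bilin_lconv[OF brt] cmap_u[OF e'.cmap_lt]]
        pconv_cancel[OF coalg_H coalg_H cmap2_bilin[OF e'.cmap_f] bilin_lconv[OF brf] cmap_u[OF e'.cmap_m]])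
qed

section \<open>Multiplicativity on arbitrary products\<close>

lemma ph_mul: "ph \<beta> (mul A a b) = ph (\<lambda>p q. \<beta> (mul A a p) q) b"
  by (intro ext) (simp add: ph_def mul_assoc)

lemma up_sw2: "up (\<lambda>p q. sw2 D z (\<lambda>x y. T x y p q)) a h c g = sw2 D z (\<lambda>x y. up (\<lambda>p q. T x y p q) a h c g)"
  unfolding up_def fm_def swp_def by (simp only: sw2_swap[of _ _ D z])

text \<open>In \<open>A \<ltimes>' H\<close> the product of \<open>a \<ltimes>' h\<close> and
  \<open>c \<ltimes>' g\<close> is a sum of elements
  \<open>a (h\<^sub>1 \<triangleright>' c\<^sub>1)\<close> times \<open>(1 \<ltimes>' (h\<^sub>2
  \<triangleleft>' c\<^sub>2)) \<bullet>' (1 \<ltimes>' g)\<close>. Assumption \<open>H\<close>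
  splits off the image of \<open>1 \<ltimes>' g\<close>, what remains is treated by assumption
  \<open>A\<close>, and associativity in \<open>A \<ltimes> H\<close> reassembles the right
  factor.\<close>

lemma phi_mult:
  assumes A: "\<And>\<beta> h c. bilin (sc A) (sc H) (*) \<beta> \<Longrightarrow>
      e'.up (ph \<beta>) (one A) h c (one H) = sw2 (cm H) h (\<lambda>h1 h2. up \<beta> (u h1) h2 c (one H))"
    and H: "\<And>\<beta> h g. bilin (sc A) (sc H) (*) \<beta> \<Longrightarrow>
      e'.up (ph \<beta>) (one A) h (one A) g = sw2 (cm H) h (\<lambda>h1 h2. sw2 (cm H) g (\<lambda>g1 g2. up \<beta> (u h1) h2 (u g1) g2))"
    and \<beta>: "bilin (sc A) (sc H) (*) \<beta>"
  shows "e'.up (ph \<beta>) a h c g = ph (\<lambda>p q. ph (\<lambda>r s. up \<beta> p q r s) c g) a h"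
proof -
  have b: "bilin (sc A) (sc H) (*) (\<lambda>p q. \<gamma> (mul A x p) q)" if "bilin (sc A) (sc H) (*) \<gamma>" for x and \<gamma> :: "'a \<Rightarrow> 'h \<Rightarrow> 'k"
    by (intro bilinI lins lin_bilin[OF that])
  \<comment> \<open>The value of \<open>\<beta>\<close> after right multiplication by the image
    \<open>u(g\<^sub>1) \<ltimes> g\<^sub>2\<close> of \<open>1 \<ltimes>' g\<close>.\<close>
  define \<Gamma> where "\<Gamma> = (\<lambda>p q. sw2 (cm H) g (\<lambda>g1 g2. up \<beta> p q (u g1) g2))"
  have \<Gamma>: "bilin (sc A) (sc H) (*) \<Gamma>"
    unfolding \<Gamma>_def by (intro bilinI lins lin_up lin_bilin[OF \<beta>])
  have "e'.fm (\<lambda>p q. ph \<beta> (mul A x p) q) l g = ph \<Gamma> x l" for x l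
  proof -
    note ph = bilin_ph[OF b[OF \<beta>, of x]]
    have "e'.fm (\<lambda>p q. ph \<beta> (mul A x p) q) l g = e'.up (ph (\<lambda>p q. \<beta> (mul A x p) q)) (one A) l (one A) g"
      by (simp add: e'.up_one_one[OF lin_bilin2[OF ph lin_id(2)] lin_bilin1[OF ph lin_id(1)]] ph_mul)
    also have "\<dots> = ph \<Gamma> x l"
      unfolding H[OF b[OF \<beta>]] by (simp add: ph_def \<Gamma>_def up_mul)
    finally show ?thesis .
  qed
  then have "e'.up (ph \<beta>) a h c g = swp H A h c (\<lambda>h1 c1 h2 c2. ph \<Gamma> (mul A a (rt' h1 c1)) (lt' h2 c2))"
    by (simp add: e'.up_def flip: mul_assoc)
  also have "\<dots> = e'.up (ph (\<lambda>p q. \<Gamma> (mul A a p) q)) (one A) h c (one H)"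
  proof -
    note ph = bilin_ph[OF b[OF \<Gamma>, of a]]
    show ?thesis
      by (simp add: e'.up_one_right[OF lin_bilin2[OF ph lin_id(2)] lin_bilin1[OF ph lin_id(1)]] ph_mul)
  qed
  also have "\<dots> = ph (\<lambda>p q. up \<Gamma> p q c (one H)) a h"
    unfolding A[OF b[OF \<Gamma>]] by (simp add: ph_def up_mul)
  also have "\<dots> = ph (\<lambda>p q. ph (\<lambda>r s. up \<beta> p q r s) c g) a h"
  proof -
    \<comment> \<open>By associativity, multiplying by \<open>c \<ltimes> 1\<close> and then by
      \<open>u(g\<^sub>1) \<ltimes> g\<^sub>2\<close> is multiplying by
      \<open>c u(g\<^sub>1) \<ltimes> g\<^sub>2\<close>, the image of
      \<open>c \<ltimes>' g\<close>.\<close>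
    have "up \<Gamma> p q c (one H) = ph (\<lambda>r s. up \<beta> p q r s) c g" for p q
    proof -
      note up = bilin_up(2)[OF \<beta>, of p q]
      show ?thesis
        by (simp add: \<Gamma>_def up_sw2 up_assoc[OF \<beta>] ph_def
            up_one_H[OF lin_bilin2[OF up lin_id(2)] lin_bilin1[OF up lin_id(1)]])
    qed
    then show ?thesis by simp
  qed
  finally show ?thesis .
qed

text \<open>The map \<open>\<Phi>\<close> is required to agree with \<open>phi_of A H u\<close> as a
  tensor only, so the results apply to a given morphism as well as to \<open>phi_of A H u\<close>
  itself.\<close>

context
  fixes \<Phi>
  assumes \<Phi>: "\<And>\<beta> a h. bilin (sc A) (sc H) (*) \<beta> \<Longrightarrow> ev2 \<beta> (\<Phi> a h) = ph \<beta> a h"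
begin

lemma ev2_morphism_mult:
  assumes \<beta>: "bilin (sc A) (sc H) (*) \<beta>"
  shows "ev2 \<beta> (extR \<Phi> (upp A (H\<lparr>mul := m'\<rparr>) lt' rt' f' a h c g)) = e'.up (ph \<beta>) a h c g"
    and "ev2 \<beta> (upm A (H\<lparr>mul := m\<rparr>) lt rt f (\<Phi> a h) (\<Phi> c g)) = ph (\<lambda>p q. ph (\<lambda>r s. up \<beta> p q r s) c g) a h"
proof -
  have "(\<lambda>a h. ev2 \<beta> (\<Phi> a h)) = ph \<beta>"
    by (simp add: fun_eq_iff \<Phi>[OF \<beta>])
  then show "ev2 \<beta> (extR \<Phi> (upp A (H\<lparr>mul := m'\<rparr>) lt' rt' f' a h c g)) = e'.up (ph \<beta>) a h c g"
    by (simp add: extR_conv_ev2 ev2_ev2 e'.ev2_upp[OF bilin_ph[OF \<beta>]])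
  have "bilin (sc A) (sc H) (*) (\<lambda>p q. ph (\<lambda>r s. up \<beta> p q r s) c g)"
    by (intro bilinI lins lin_up lin_bilin[OF \<beta>])
  then show "ev2 \<beta> (upm A (H\<lparr>mul := m\<rparr>) lt rt f (\<Phi> a h) (\<Phi> c g)) = ph (\<lambda>p q. ph (\<lambda>r s. up \<beta> p q r s) c g) a h"
    by (simp add: ev2_upm[OF \<beta>] \<Phi>[OF bilin_up(2)[OF \<beta>]] \<Phi>)
qed

text \<open>Multiplicativity is specialised to right factors \<open>c \<ltimes>' 1\<close> and
  \<open>1 \<ltimes>' g\<close> with left factor \<open>1 \<ltimes>' h\<close>. The equivalences for
  these products and \<open>conds_iff\<close> give the claims.\<close>

lemma morphism_conds:
  assumes "\<forall>a h c g. teq2 (sc A) (sc H) (extR \<Phi> (upp A (H\<lparr>mul := m'\<rparr>) lt' rt' f' a h c g))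
    (upm A (H\<lparr>mul := m\<rparr>) lt rt f (\<Phi> a h) (\<Phi> c g))"
  shows "lt' = lt" "conds A SA (H\<lparr>mul := m\<rparr>) lt rt f m' rt' f' u"
proof -
  have mult: "e'.up (ph \<beta>) a h c g = ph (\<lambda>p q. ph (\<lambda>r s. up \<beta> p q r s) c g) a h"
    if \<beta>: "bilin (sc A) (sc H) (*) \<beta>" for \<beta> a h c g
    using assms[unfolded teq2_def, rule_format, OF \<beta>, of a h c g] by (simp add: ev2_morphism_mult[OF \<beta>])
  have "e'.up (ph \<beta>) (one A) h c (one H) = sw2 (cm H) h (\<lambda>h1 h2. up \<beta> (u h1) h2 c (one H))"
    if \<beta>: "bilin (sc A) (sc H) (*) \<beta>" for \<beta> h c
    unfolding mult[OF \<beta>] ph_one[OF bilin_up(2)[OF \<beta>]] by (simp add: ph_def)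
  then have 1: "pconv H A rt' (\<lambda>h c. u (lt' h c)) = lconv rt \<and> lt' = lt"
    using phi_mult_A_iff by blast
  have "e'.up (ph \<beta>) (one A) h (one A) g = sw2 (cm H) h (\<lambda>h1 h2. sw2 (cm H) g (\<lambda>g1 g2. up \<beta> (u h1) h2 (u g1) g2))"
    if \<beta>: "bilin (sc A) (sc H) (*) \<beta>" for \<beta> h g
    unfolding mult[OF \<beta>] by (simp add: ph_def)
  then have "pconv H H f' (\<lambda>h g. u (m' h g)) = lconv (pconv H H R F) \<and> m' = M"
    using phi_mult_H_iff by blast
  with 1 show "lt' = lt" "conds A SA (H\<lparr>mul := m\<rparr>) lt rt f m' rt' f' u"
    using conds_iff by blast+
qed

lemma tiso_morphism: "tiso A (H\<lparr>mul := m\<rparr>) \<Phi>"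
proof -
  \<comment> \<open>The inverse is the same construction with \<open>SA \<circ> u\<close>, the
    convolution inverse of \<open>u\<close>, in place of \<open>u\<close>.\<close>
  define \<Psi> where "\<Psi> a h = sw2 (cm H) h (\<lambda>h1 h2. {#(mul A a (SA (u h1)), h2)#})" for a h
  have \<Psi>: "ev2 \<beta> (\<Psi> a h) = sw2 (cm H) h (\<lambda>h1 h2. \<beta> (mul A a (SA (u h1))) h2)" for \<beta> :: "'a \<Rightarrow> 'h \<Rightarrow> 'k" and a h
    by (simp add: \<Psi>_def ev2_sw2)
  have b\<Psi>: "bilin (sc A) (sc H) (*) (\<lambda>a h. ev2 \<beta> (\<Psi> a h))" if \<beta>: "bilin (sc A) (sc H) (*) \<beta>" for \<beta>
    unfolding \<Psi> by (intro bilinI lins lin_comult[OF coalg_H] lin_bilin[OF \<beta>])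
  have uS: "sw2 (cm H) z (\<lambda>x y. \<beta> (mul A a (mul A (u x) (SA (u y)))) h) = cu H z * \<beta> a h"
    and Su: "sw2 (cm H) z (\<lambda>x y. \<beta> (mul A a (mul A (SA (u x)) (u y))) h) = cu H z * \<beta> a h"
    if \<beta>: "bilin (sc A) (sc H) (*) \<beta>" for \<beta> z a h
  proof -
    have "sw2 (cm H) z (\<lambda>x y. mul A (u x) (SA (u y))) = sw2 (cm A) (u z) (\<lambda>x y. mul A x (SA y))"
      "sw2 (cm H) z (\<lambda>x y. mul A (SA (u x)) (u y)) = sw2 (cm A) (u z) (\<lambda>x y. mul A (SA x) y)"
      by (subst comult_u[where t = "sc A"]; (intro lins refl)?)+
    then have *: "sw2 (cm H) z (\<lambda>x y. mul A (u x) (SA (u y))) = sc A (cu H z) (one A)"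
      "sw2 (cm H) z (\<lambda>x y. mul A (SA (u x)) (u y)) = sc A (cu H z) (one A)"
      by (simp_all add: antipode_left antipode_right counit_u)
    have "lin (sc A) (*) (\<lambda>x. \<beta> (mul A a x) h)"
      by (intro lins lin_bilin[OF \<beta>])
    note pull = this[THEN lin_sw2, symmetric]
    show "sw2 (cm H) z (\<lambda>x y. \<beta> (mul A a (mul A (u x) (SA (u y)))) h) = cu H z * \<beta> a h"
      "sw2 (cm H) z (\<lambda>x y. \<beta> (mul A a (mul A (SA (u x)) (u y))) h) = cu H z * \<beta> a h"
      by (simp_all add: pull * mul_scale bilinD(4)[OF \<beta>])
  qed
  have "ev2 \<beta> (extR \<Psi> (\<Phi> a h)) = \<beta> a h" "ev2 \<beta> (extR \<Phi> (\<Psi> a h)) = \<beta> a h"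
    if \<beta>: "bilin (sc A) (sc H) (*) \<beta>" for \<beta> a h
  proof -
    have "ev2 \<beta> (extR \<Psi> (\<Phi> a h)) = sw2 (cm H) h (\<lambda>h1 h2. sw2 (cm H) h2 (\<lambda>x y. \<beta> (mul A a (mul A (u h1) (SA (u x)))) y))"
      by (simp add: extR_conv_ev2 ev2_ev2 \<Phi>[OF b\<Psi>[OF \<beta>]]) (simp add: \<Psi> ph_def mul_assoc)
    also have "\<dots> = sw2 (cm H) h (\<lambda>z y. sw2 (cm H) z (\<lambda>h1 x. \<beta> (mul A a (mul A (u h1) (SA (u x)))) y))"
      by (rule sw2_coassoc[OF coalg_H, where t = "(*)", symmetric]) (intro lins lin_bilin[OF \<beta>])+
    also have "\<dots> = \<beta> a h"
      by (simp only: uS[OF \<beta>]) (rule sw2_counit_left[OF coalg_H lin_bilin2[OF \<beta> lin_id(2)]])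
    finally show "ev2 \<beta> (extR \<Psi> (\<Phi> a h)) = \<beta> a h" .
    have "ev2 \<beta> (extR \<Phi> (\<Psi> a h)) = sw2 (cm H) h (\<lambda>h1 h2. sw2 (cm H) h2 (\<lambda>x y. \<beta> (mul A a (mul A (SA (u h1)) (u x))) y))"
      by (simp add: extR_conv_ev2 ev2_ev2 \<Phi>[OF \<beta>] \<Psi>) (simp add: ph_def mul_assoc)
    also have "\<dots> = sw2 (cm H) h (\<lambda>z y. sw2 (cm H) z (\<lambda>h1 x. \<beta> (mul A a (mul A (SA (u h1)) (u x))) y))"
      by (rule sw2_coassoc[OF coalg_H, where t = "(*)", symmetric]) (intro lins lin_bilin[OF \<beta>])+
    also have "\<dots> = \<beta> a h"
      by (simp only: Su[OF \<beta>]) (rule sw2_counit_left[OF coalg_H lin_bilin2[OF \<beta> lin_id(2)]])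
    finally show "ev2 \<beta> (extR \<Phi> (\<Psi> a h)) = \<beta> a h" .
  qed
  then show ?thesis
    unfolding tiso_def tlin_def teq2_def by (intro exI[of _ \<Psi>]) (simp add: b\<Psi>)
qed

end

text \<open>The seven cases follow the conjuncts of \<open>good_morph\<close>. Colinearity is
  coassociativity, multiplicativity comes from the generating products, and comultiplicativity rests
  on laziness.\<close>

lemma good_morph_phi:
  assumes lt: "lt' = lt" and conds: "conds A SA (H\<lparr>mul := m\<rparr>) lt rt f m' rt' f' u"
  shows "good_morph A (H\<lparr>mul := m\<rparr>) lt rt f (H\<lparr>mul := m'\<rparr>) lt' rt' f' (phi_of A H u)"
proof -
  have mA: "e'.up (ph \<beta>) (one A) h c (one H) = sw2 (cm H) h (\<lambda>h1 h2. up \<beta> (u h1) h2 c (one H))"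
    if "bilin (sc A) (sc H) (*) \<beta>" for \<beta> h c
    using that phi_mult_A_iff conds conds_iff[OF lt] lt by blast
  have mH: "e'.up (ph \<beta>) (one A) h (one A) g = sw2 (cm H) h (\<lambda>h1 h2. sw2 (cm H) g (\<lambda>g1 g2. up \<beta> (u h1) h2 (u g1) g2))"
    if "bilin (sc A) (sc H) (*) \<beta>" for \<beta> h g
    using that phi_mult_H_iff conds conds_iff[OF lt] by blast
  show ?thesis
    unfolding good_morph_def tlin_def teq2_def teq3_def teq4_def
  proof (intro conjI allI impI, goal_cases)
    case (1 \<beta>)
    then show ?case by (simp add: ev2_phi bilin_ph)
  next
    case (2 b a h \<beta>)
    then show ?case by (simp add: image_mset_conv_ev2 ev2_ev2 ev2_phi ph_mul)
  next
    case (3 a h \<tau>)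
    then have "trilin (sc A) (sc H) (sc H) (*) \<tau>" by simp
    note \<tau> = lin_trilin[OF this]
    have "sw2 (cm H) h (\<lambda>h1 h2. sw2 (cm H) h1 (\<lambda>x y. \<tau> (mul A a (u x)) y h2))
      = sw2 (cm H) h (\<lambda>h1 h2. sw2 (cm H) h2 (\<lambda>q1 q2. \<tau> (mul A a (u h1)) q1 q2))"
      by (rule sw2_coassoc[OF coalg_H, where t = "(*)"]) (intro \<tau> lins)+
    then show ?case
      unfolding ev2_def[symmetric]
      by (simp add: image_mset_conv_ev2 ev3_ev2 ev3_sw2 ev2_phi ph_def)
  next
    case (4 a h c g \<beta>)
    then have \<beta>: "bilin (sc A) (sc H) (*) \<beta>" by simp
    show ?case
      by (simp add: ev2_morphism_mult[OF ev2_phi \<beta>] phi_mult[OF mA mH \<beta>])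
  next
    case (5 \<beta>)
    then show ?case by (simp add: ev2_phi ph_one)
  next
    \<comment> \<open>Comultiplying \<open>a u(h\<^sub>1) \<otimes> h\<^sub>2\<close> gives
      \<open>a\<^sub>1 u(h\<^sub>1) \<otimes> h\<^sub>3 \<otimes> a\<^sub>2 u(h\<^sub>2) \<otimes>
      h\<^sub>4\<close>; laziness exchanges the middle indices 2 and 3.\<close>
    case (6 a h \<chi>)
    then have "quadlin (sc A) (sc H) (sc A) (sc H) (*) \<chi>" by simp
    note \<chi> = lin_quadlin[OF this]
    have "sw2 (cm H) h (\<lambda>h1 h2. sw2 (cm A) (mul A a (u h1)) (\<lambda>p p'. sw2 (cm H) h2 (\<lambda>q q'. \<chi> p q p' q')))
      = sw2 (cm H) h (\<lambda>h1 h2. sw2 (cm A) a (\<lambda>a1 a2. sw2 (cm H) h1 (\<lambda>x y. sw2 (cm H) h2 (\<lambda>q q'. \<chi> (mul A a1 (u x)) q (mul A a2 (u y)) q'))))"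
      unfolding swp_def
      by (subst comult_mul[where t = "(*)"], (intro lins \<chi>)+, unfold swp_def,
          subst comult_u[where t = "(*)"]) (intro lins \<chi> refl)+
    also have "\<dots> = sw2 (cm A) a (\<lambda>a1 a2. sw2 (cm H) h (\<lambda>h1 h2. sw2 (cm H) h1 (\<lambda>x y. sw2 (cm H) h2 (\<lambda>q q'. \<chi> (mul A a1 (u x)) q (mul A a2 (u y)) q'))))"
      by (rule sw2_swap)
    also have "\<dots> = sw2 (cm A) a (\<lambda>a1 a2. sw2 (cm H) h (\<lambda>h1 h2. sw2 (cm H) h1 (\<lambda>x q. sw2 (cm H) h2 (\<lambda>y q'. \<chi> (mul A a1 (u x)) q (mul A a2 (u y)) q'))))"
      by (subst u_lazy_middle[where t = "(*)"]) (intro lins \<chi> refl)+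
    finally show ?case
      by (simp add: cmR_conv_ev2 ev4_ev2 ev2_phi ph_def ev4_cmT ev4_pair4 flip: ev4_def)
        (simp add: ev4_sw2 ev4_pair4 ev2_phi ph_def)
  next
    case (7 a h)
    show ?case
      by (simp add: cuR_conv_ev2 ev2_phi ph_def counit_mul counit_u)
        (simp add: mult.assoc mult.left_commute[of "cu A a"]
          sw2_counit_left[OF coalg_H lin_mult_left[OF lin_cuH[OF lin_id(2)]]])
  qed
qed

end

text \<open>Applying \<open>id \<otimes> \<epsilon> \<otimes> id\<close> to colinearity gives \<open>\<Phi> (1 \<otimes> h) = u(h\<^sub>1) \<otimes> h\<^sub>2\<close>.\<close>
lemma (in ext_hopf) cocycle_of_morphism:
  assumes \<Phi>: "good_morph A (H\<lparr>mul := m\<rparr>) lt rt f H' lt' rt' f' \<Phi>"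
  shows "\<exists>u. lazy_cocycle A H u \<and> (\<forall>a h. teq2 (sc A) (sc H) (\<Phi> a h) (phi_of A H u a h))"
proof -
  define u where "u h = ev2 (\<lambda>p q. sc A (cu H q) p) (\<Phi> (one A) h)" for h
  have lin_\<Phi>: "lin s (sc A) K \<Longrightarrow> lin s (*) (\<lambda>x. ev2 \<beta> (\<Phi> (K x) h))" "lin s (sc H) L \<Longrightarrow> lin s (*) (\<lambda>x. ev2 \<beta> (\<Phi> a (L x)))"
    if "bilin (sc A) (sc H) (*) \<beta>" for s K L a h \<beta>
  proof -
    have b: "bilin (sc A) (sc H) (*) (\<lambda>a h. ev2 \<beta> (\<Phi> a h))"
      using \<Phi> that by (simp add: good_morph_def tlin_def)
    show "lin s (sc A) K \<Longrightarrow> lin s (*) (\<lambda>x. ev2 \<beta> (\<Phi> (K x) h))"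
      "lin s (sc H) L \<Longrightarrow> lin s (*) (\<lambda>x. ev2 \<beta> (\<Phi> a (L x)))"
      by (rule lin_bilin1[OF b] lin_bilin2[OF b]; assumption)+
  qed
  have form_u: "ev2 (\<lambda>p q. cu H q * \<phi> p) (\<Phi> (one A) h) = \<phi> (u h)" if \<phi>: "lin (sc A) (*) \<phi>" for \<phi> h
    by (simp add: u_def lin_ev2[OF \<phi>] linD(4)[OF \<phi>])
  then have form_u': "ev2 (\<lambda>p q. c * (cu H q * \<phi> p)) (\<Phi> (one A) h) = c * \<phi> (u h)"
    if "lin (sc A) (*) \<phi>" for c \<phi> h
    using that lin_ev2[OF lin_mult_left[OF lin_ident[OF vector_space_mult]], symmetric] by metis
  have lin_u: "lin (sc H) (sc A) u"
  proof (rule lin_by_forms[OF vs_H vs_A])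
    fix \<phi> :: "'a \<Rightarrow> 'k" assume \<phi>: "lin (sc A) (*) \<phi>"
    have "bilin (sc A) (sc H) (*) (\<lambda>p q. cu H q * \<phi> p)"
      by (intro bilinI lins lin_comp[OF \<phi>])
    from lin_\<Phi>(2)[OF this lin_id(2), of "one A"] show "lin (sc H) (*) (\<lambda>x. \<phi> (u x))"
      by (simp add: form_u[OF \<phi>])
  qed
  note lin_u' = lin_comp[OF lin_u]
  have key: "ev2 \<beta> (\<Phi> a h) = sw2 (cm H) h (\<lambda>h1 h2. \<beta> (mul A a (u h1)) h2)"
    if \<beta>: "bilin (sc A) (sc H) (*) \<beta>" for \<beta> a h
  proof -
    have \<tau>: "trilin (sc A) (sc H) (sc H) (*) (\<lambda>p q r. cu H q * \<beta> p r)"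
      by (intro trilinI lins lin_bilin[OF \<beta>])
    have "sw2 (cm H) h (\<lambda>h1 h2. ev2 (\<lambda>p q. cu H q * \<beta> p h2) (\<Phi> a h1))
      = ev2 (\<lambda>p q. sw2 (cm H) q (\<lambda>q1 q2. cu H q1 * \<beta> p q2)) (\<Phi> a h)"
    proof -
      have "teq3 (sc A) (sc H) (sc H) (sw2 (cm H) h (\<lambda>h1 h2. image_mset (\<lambda>(p, q). (p, q, h2)) (\<Phi> a h1)))
          (\<Sum>(p, q)\<in>#\<Phi> a h. sw2 (cm H) q (\<lambda>q1 q2. {#(p, q1, q2)#}))"
        using \<Phi> by (simp add: good_morph_def)
      from this[unfolded teq3_def, rule_format, OF \<tau>] show ?thesis
        unfolding ev2_def[symmetric] by (simp add: image_mset_conv_ev2 ev3_ev2 ev3_sw2)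
    qed
    also have "\<dots> = ev2 \<beta> (\<Phi> a h)"
      by (simp add: sw2_counit_left[OF coalg_H lin_bilin2[OF \<beta> lin_id(2)]])
    finally have "ev2 \<beta> (\<Phi> a h) = sw2 (cm H) h (\<lambda>h1 h2. ev2 (\<lambda>p q. cu H q * \<beta> p h2) (\<Phi> a h1))" ..
    \<comment> \<open>Left \<open>A\<close>-linearity reduces to \<open>\<Phi> (one A) h1\<close>,
      where the counit on the second component produces \<open>u h1\<close> by definition.\<close>
    moreover have "ev2 (\<lambda>p q. cu H q * \<beta> p h2) (\<Phi> a h1) = \<beta> (mul A a (u h1)) h2" for h1 h2
    proof -
      have b: "bilin (sc A) (sc H) (*) (\<lambda>p q. cu H q * \<beta> p h2)"
        by (intro bilinI lins lin_bilin[OF \<beta>])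
      have "teq2 (sc A) (sc H) (\<Phi> (mul A a (one A)) h1) (image_mset (\<lambda>(p, q). (mul A a p, q)) (\<Phi> (one A) h1))"
        using \<Phi> by (simp add: good_morph_def del: mul_one)
      from this[unfolded teq2_def, rule_format, OF b]
      have "ev2 (\<lambda>p q. cu H q * \<beta> p h2) (\<Phi> a h1) = ev2 (\<lambda>p q. cu H q * \<beta> (mul A a p) h2) (\<Phi> (one A) h1)"
        by (simp add: image_mset_conv_ev2 ev2_ev2)
      also have "\<dots> = \<beta> (mul A a (u h1)) h2"
        by (rule form_u) (intro lins lin_bilin[OF \<beta>])
      finally show ?thesis .
    qed
    ultimately show ?thesis by simp
  qed
  \<comment> \<open>Comultiplicativity of \<open>\<Phi>\<close> at \<open>one A \<otimes> h\<close>,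
    simplified by the fact that \<open>one A\<close> is grouplike.\<close>
  have coalg: "ev2 (\<lambda>p q. sw2 (cm A) p (\<lambda>p1 p2. sw2 (cm H) q (\<lambda>q1 q2. \<chi> p1 q1 p2 q2))) (\<Phi> (one A) h)
      = sw2 (cm H) h (\<lambda>h1 h2. ev2 (\<lambda>p q. ev2 (\<lambda>r s. \<chi> p q r s) (\<Phi> (one A) h2)) (\<Phi> (one A) h1))"
    if \<chi>: "quadlin (sc A) (sc H) (sc A) (sc H) (*) \<chi>" for \<chi> h
  proof -
    have 1: "bilin (sc A) (sc H) (*) (\<lambda>p q. \<chi> a h p q)" for a h
      by (intro bilinI lin_quadlin[OF \<chi>] lins)
    have 2: "bilin (sc A) (sc H) (*) (\<lambda>p q. ev2 (\<lambda>r s. \<chi> p q r s) X)" for X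
      by (intro bilinI lin_ev2_body vs_A vs_H vector_space_mult lin_quadlin[OF \<chi>] lins)
    have "sw2 (cm A) (one A) (\<lambda>a1 a2. sw2 (cm H) h (\<lambda>h1 h2. ev2 (\<lambda>p q. ev2 (\<lambda>r s. \<chi> p q r s) (\<Phi> a2 h2)) (\<Phi> a1 h1)))
      = sw2 (cm H) h (\<lambda>h1 h2. ev2 (\<lambda>p q. ev2 (\<lambda>r s. \<chi> p q r s) (\<Phi> (one A) h2)) (\<Phi> (one A) h1))"
      by (rule comult_one[where t = "(*)"])
        (intro lins lin_ev2_body vs_A vector_space_mult lin_\<Phi>(1)[OF 1] lin_\<Phi>(1)[OF 2])+
    moreover have "ev4 \<chi> (cmR A (H\<lparr>mul := m\<rparr>) (\<Phi> (one A) h))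
      = ev4 \<chi> (ev4 (\<lambda>a1 h1 a2 h2. pair4 (\<Phi> a1 h1) (\<Phi> a2 h2)) (cmT A (H\<lparr>mul := m\<rparr>) (one A) h))"
      using \<Phi> \<chi> by (simp add: good_morph_def teq4_def ev4_def)
    ultimately show ?thesis
      by (simp add: cmR_conv_ev2 ev4_ev2 ev4_ev4 ev4_sw2 ev4_cmT ev4_pair4)
  qed
  have counit_u: "cu A (u h) = cu H h" for h
  proof -
    have "cuR A (H\<lparr>mul := m\<rparr>) (\<Phi> (one A) h) = cu H h"
      using \<Phi> by (simp add: good_morph_def)
    with form_u[OF lin_cuA[OF lin_id(1)], of h] show ?thesis
      by (simp add: cuR_conv_ev2 mult.commute)
  qed
  have "lazy_cocycle A H u"
    unfolding lazy_cocycle_def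
  proof (intro conjI allI lin_u)
    have "teq2 (sc A) (sc H) (\<Phi> (one A) (one H)) {#(one A, one H)#}"
      using \<Phi> by (simp add: good_morph_def)
    from teq2D[OF this, of "sc A" "\<lambda>p q. sc A (cu H q) p"] show "u (one H) = one A"
      by (simp add: u_def lins lin_scale lin_scale_right[OF lin_id(1)] vs_A vector_space.vector_space_assms(4)[OF vs_A])
  next
    fix h
    show "cu A (u h) = cu H h" by (rule counit_u)
    show "teq2 (sc A) (sc A) (cm A (u h)) (sw2 (cm H) h (\<lambda>x y. {#(u x, u y)#}))"
      unfolding teq2_def
    proof (intro allI impI)
      fix \<beta> :: "'a \<Rightarrow> 'a \<Rightarrow> 'k" assume \<beta>: "bilin (sc A) (sc A) (*) \<beta>"
      \<comment> \<open>Applying the counit to both \<open>H\<close>-components leaves the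
        comultiplicativity of \<open>u\<close>.\<close>
      have \<chi>: "quadlin (sc A) (sc H) (sc A) (sc H) (*) (\<lambda>p q r s. cu H q * (cu H s * \<beta> p r))"
        by (intro quadlinI lins lin_bilin[OF \<beta>])
      have "ev2 \<beta> (cm A (u h)) = ev2 (\<lambda>p q. cu H q * sw2 (cm A) p \<beta>) (\<Phi> (one A) h)"
        unfolding sw2_def[symmetric]
        by (rule form_u[symmetric]) (intro lin_comult[OF coalg_A] lins lin_bilin[OF \<beta>])
      also have "\<dots> = ev2 (\<lambda>p q. sw2 (cm A) p (\<lambda>p1 p2. sw2 (cm H) q (\<lambda>q1 q2. cu H q1 * (cu H q2 * \<beta> p1 p2)))) (\<Phi> (one A) h)"
        by (simp add: sw2_counit_left[OF coalg_H lin_mult_right[OF lin_cuH[OF lin_id(2)]]] mult_sw2_left)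
      also have "\<dots> = sw2 (cm H) h (\<lambda>h1 h2. ev2 (\<lambda>p q. ev2 (\<lambda>r s. cu H q * (cu H s * \<beta> p r)) (\<Phi> (one A) h2)) (\<Phi> (one A) h1))"
        by (rule coalg[OF \<chi>])
      also have "\<dots> = sw2 (cm H) h (\<lambda>x y. \<beta> (u x) (u y))"
      proof -
        have "ev2 (\<lambda>r s. cu H q * (cu H s * \<beta> p r)) (\<Phi> (one A) h) = cu H q * \<beta> p (u h)" for p q h
          by (rule form_u'[OF lin_bilin2[OF \<beta> lin_id(1)]])
        then show ?thesis by (simp add: form_u[OF lin_bilin1[OF \<beta> lin_id(1)]])
      qed
      finally show "ev2 \<beta> (cm A (u h)) = ev2 \<beta> (sw2 (cm H) h (\<lambda>x y. {#(u x, u y)#}))"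
        by (simp add: ev2_sw2)
    qed
    show "teq2 (sc H) (sc A) (sw2 (cm H) h (\<lambda>x y. {#(x, u y)#})) (sw2 (cm H) h (\<lambda>x y. {#(y, u x)#}))"
      unfolding teq2_def
    proof (intro allI impI)
      fix \<beta> :: "'h \<Rightarrow> 'a \<Rightarrow> 'k" assume \<beta>: "bilin (sc H) (sc A) (*) \<beta>"
      \<comment> \<open>The counit is applied to the outer two components and the middle two are
        kept. One side of comultiplicativity then becomes
        \<open>h\<^sub>2 \<otimes> u(h\<^sub>1)\<close>, the other
        \<open>h\<^sub>1 \<otimes> u(h\<^sub>2)\<close>, which is laziness.\<close>
      have \<chi>: "quadlin (sc A) (sc H) (sc A) (sc H) (*) (\<lambda>p q r s. cu A p * (cu H s * \<beta> q r))"
        by (intro quadlinI lins lin_bilin[OF \<beta>])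
      have "sw2 (cm H) h (\<lambda>x y. \<beta> y (u x)) = ev2 (\<lambda>p q. \<beta> q p) (\<Phi> (one A) h)"
        by (subst key) (intro bilinI lin_bilin[OF \<beta>] lins | simp)+
      also have "\<dots> = ev2 (\<lambda>p q. sw2 (cm A) p (\<lambda>p1 p2. sw2 (cm H) q (\<lambda>q1 q2. cu A p1 * (cu H q2 * \<beta> q1 p2)))) (\<Phi> (one A) h)"
        by (simp add: sw2_counit_right[OF coalg_H lin_bilin1[OF \<beta> lin_id(2)]]
            sw2_counit_left[OF coalg_A lin_bilin2[OF \<beta> lin_id(1)]] flip: mult_sw2_left)
      also have "\<dots> = sw2 (cm H) h (\<lambda>h1 h2. ev2 (\<lambda>p q. ev2 (\<lambda>r s. cu A p * (cu H s * \<beta> q r)) (\<Phi> (one A) h2)) (\<Phi> (one A) h1))"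
        by (rule coalg[OF \<chi>])
      also have "\<dots> = sw2 (cm H) h (\<lambda>x y. \<beta> x (u y))"
      proof -
        have "ev2 (\<lambda>r s. cu A p * (cu H s * \<beta> q r)) (\<Phi> (one A) h) = cu A p * \<beta> q (u h)" for p q h
          by (rule form_u'[OF lin_bilin2[OF \<beta> lin_id(1)]])
        moreover have "ev2 (\<lambda>p q. cu A p * \<beta> q a) (\<Phi> (one A) h) = \<beta> h a" for a h
        proof -
          have "bilin (sc A) (sc H) (*) (\<lambda>p q. cu A p * \<beta> q a)"
            by (intro bilinI lins lin_bilin[OF \<beta>])
          from key[OF this] show ?thesis
            by (simp add: counit_u sw2_counit_left[OF coalg_H lin_bilin1[OF \<beta> lin_id(2)]])
        qed
        ultimately show ?thesis by simp
      qed
      finally show "ev2 \<beta> (sw2 (cm H) h (\<lambda>x y. {#(x, u y)#})) = ev2 \<beta> (sw2 (cm H) h (\<lambda>x y. {#(y, u x)#}))"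
        by (simp add: ev2_sw2)
    qed
  qed
  moreover have "teq2 (sc A) (sc H) (\<Phi> a h) (phi_of A H u a h)" for a h
    by (simp add: teq2_def key phi_of_def ev2_sw2)
  ultimately show ?thesis by blast
qed

section \<open>Correspondence between morphisms and lazy cocycles\<close>

theorem theorem3p4:
  fixes A :: "('k::field, 'a::ab_group_add) kstr" and SA :: "'a \<Rightarrow> 'a"
    and H :: "('k, 'h::ab_group_add) kstr" and mH' :: "'h \<Rightarrow> 'h \<Rightarrow> 'h"
    and lt lt' :: "'h \<Rightarrow> 'a \<Rightarrow> 'h" and rt rt' :: "'h \<Rightarrow> 'a \<Rightarrow> 'a" and f f' :: "'h \<Rightarrow> 'h \<Rightarrow> 'a"
  assumes "hopf_alg A SA"
    and "hopf_ext A H lt rt f"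
    and "hopf_ext A (H\<lparr>mul := mH'\<rparr>) lt' rt' f'"
  shows "((\<exists>\<Phi>. good_morph A H lt rt f (H\<lparr>mul := mH'\<rparr>) lt' rt' f' \<Phi>)
           \<longleftrightarrow> (lt' = lt \<and> (\<exists>u. lazy_cocycle A H u \<and> conds A SA H lt rt f mH' rt' f' u)))
     \<and> (\<forall>\<Phi>. good_morph A H lt rt f (H\<lparr>mul := mH'\<rparr>) lt' rt' f' \<Phi> \<longrightarrow>
           (\<exists>u. lazy_cocycle A H u \<and> conds A SA H lt rt f mH' rt' f' u
                \<and> (\<forall>a h. teq2 (sc A) (sc H) (\<Phi> a h) (phi_of A H u a h)) \<and> tiso A H \<Phi>))
     \<and> (lt' = lt \<longrightarrow> (\<forall>u. lazy_cocycle A H u \<and> conds A SA H lt rt f mH' rt' f' u \<longrightarrow>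
           good_morph A H lt rt f (H\<lparr>mul := mH'\<rparr>) lt' rt' f' (phi_of A H u) \<and> tiso A H (phi_of A H u)))"
proof -
  \<comment> \<open>Updating \<open>H\<close> with its own multiplication returns \<open>H\<close>,
    so the first structure is an instance too.\<close>
  interpret ext_hopf A SA H "mul H" lt rt f
    using assms by unfold_locales simp_all
  interpret e': ext_hopf A SA H mH' lt' rt' f'
    using assms by unfold_locales
  have pair: "cocycle_pair A SA H (mul H) lt rt f mH' lt' rt' f' u" if "lazy_cocycle A H u" for u
    using that by unfold_locales
  have necessary: "lt' = lt \<and> (\<exists>u. lazy_cocycle A H u \<and> conds A SA H lt rt f mH' rt' f' u
      \<and> (\<forall>a h. teq2 (sc A) (sc H) (\<Phi> a h) (phi_of A H u a h)) \<and> tiso A H \<Phi>)"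
    if \<Phi>: "good_morph A H lt rt f (H\<lparr>mul := mH'\<rparr>) lt' rt' f' \<Phi>" for \<Phi>
  proof -
    obtain u where u: "lazy_cocycle A H u" and eq: "\<And>a h. teq2 (sc A) (sc H) (\<Phi> a h) (phi_of A H u a h)"
      using cocycle_of_morphism[of "H\<lparr>mul := mH'\<rparr>" lt' rt' f' \<Phi>] \<Phi> by auto
    interpret cocycle_pair A SA H "mul H" lt rt f mH' lt' rt' f' u
      by (rule pair[OF u])
    have ph: "ev2 \<beta> (\<Phi> a h) = ph \<beta> a h" if "bilin (sc A) (sc H) (*) \<beta>" for \<beta> a h
      using eq[unfolded teq2_def] that by (simp add: ev2_phi)
    show ?thesis
      using morphism_conds[OF ph] tiso_morphism[OF ph] \<Phi> u eq by (auto simp: good_morph_def)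
  qed
  have sufficient: "good_morph A H lt rt f (H\<lparr>mul := mH'\<rparr>) lt' rt' f' (phi_of A H u) \<and> tiso A H (phi_of A H u)"
    if lt: "lt' = lt" and u: "lazy_cocycle A H u" and "conds A SA H lt rt f mH' rt' f' u" for u
  proof -
    interpret cocycle_pair A SA H "mul H" lt rt f mH' lt' rt' f' u
      by (rule pair[OF u])
    show ?thesis
      using good_morph_phi[OF lt] tiso_morphism[OF ev2_phi] that(3) by simp
  qed
  show ?thesis
    using necessary sufficient by blast
qed

end
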